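(* Assume that $F=u\,\phi(r,s)$ is a spherically symmetric Finsler metric. Then $F$ admits a (nonzero) parallel 1-form $\beta=b_iy^i$ if and only if its geodesic spray is determined by functions of the form $$P=P(r,s),\qquad Q=\frac{s^2f'(r)}{2r^3f(r)}-\frac{sP}{r^2}+\frac{1}{2r^2},$$ where $b_i=f(r)x_i$, $f'=\frac{df}{dr}$, and $f(r)$ is a smooth function of $r$.
   Context: A Finsler metric $F$ on the ball $\mathbb{B}^n(r_0)\subset\mathbb{R}^n$, $n\ge2$ (positive and smooth for $y\neq0$, positively 1-homogeneous in $y$, with $g_{ij}=\frac{\partial^2}{\partial y^i\partial y^j}(\tfrac12F^2)$ of rank $n$), is spherically symmetric if $F(x,y)=u\,\phi(r,s)$ with $r=|x|$, $u=|y|$, $s=\frac{\langle x,y\rangle}{|y|}$ and $\phi:[0,r_0)\times\mathbb{R}\to\mathbb{R}$; norms and inner products are Euclidean, and $x_i=\delta_{ij}x^j$. Its geodesic spray coefficients $G^i=\tfrac14 g^{il}\left(y^k\frac{\partial^2F^2}{\partial x^k\partial y^l}-\frac{\partial F^2}{\partial x^l}\right)$ have the form $G^i=uPy^i+u^2Qx^i$ with $$P=-\frac{Q}{\phi}\left(s\phi+(r^2-s^2)\phi_s\right)+\frac{1}{2r\phi}(s\phi_r+r\phi_s),\qquad Q=\frac{1}{2r}\,\frac{-\phi_r+s\phi_{rs}+r\phi_{ss}}{\phi-s\phi_s+(r^2-s^2)\phi_{ss}},$$ subscripts denoting partial derivatives; the spray is said to be determined by the functions $P,Q$. A 1-form $\beta=b_i(x)y^i$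 is parallel if $b_{i|j}=\frac{\partial b_i}{\partial x^j}-G^h_{ij}b_h=0$ for all $x$ and $y\ne0$, where $G^h_{ij}=\frac{\partial^2G^h}{\partial y^i\partial y^j}$ (Berwald horizontal covariant derivative). Parallel 1-forms are understood to be nonzero. *)

theory Defs
  imports "HOL-Analysis.Analysis"
begin

text \<open>Functions of class C^k and of class C^infinity on a set; only used for open sets.\<close>

primrec Ck_on :: "nat \<Rightarrow> 'a::euclidean_space set \<Rightarrow> ('a \<Rightarrow> 'b::real_normed_vector) \<Rightarrow> bool" where
  "Ck_on 0 S f \<longleftrightarrow> continuous_on S f"
| "Ck_on (Suc k) S f \<longleftrightarrow>
     f differentiable_on S \<and> (\<forall>v. Ck_on k S (\<lambda>x. frechet_derivative f (at x) v))"

definition smooth_on :: "'a::euclidean_space set \<Rightarrow> ('a \<Rightarrow> 'b::real_normed_vector) \<Rightarrow> bool" where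
  "smooth_on S f \<longleftrightarrow> (\<forall>k. Ck_on k S f)"

definition partial :: "'n::finite \<Rightarrow> (real^'n \<Rightarrow> real) \<Rightarrow> real^'n \<Rightarrow> real" where
  "partial i f x = deriv (\<lambda>t. f (x + t *\<^sub>R axis i 1)) 0"

text \<open>A metric is a function \<open>F x y\<close> of the point \<open>x\<close> and the tangent vector \<open>y\<close>.\<close>

definition fundamental_tensor ::
    "(real^'n \<Rightarrow> real^'n \<Rightarrow> real) \<Rightarrow> real^'n \<Rightarrow> real^'n \<Rightarrow> real^'n::finite^'n" where
  "fundamental_tensor F x y =
     (\<chi> i j. partial i (\<lambda>v. partial j (\<lambda>w. 1/2 * (F x w)\<^sup>2) v) y)"

text \<open>Only nondegeneracy of the fundamental tensor is required, not positive definiteness.\<close>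

definition finsler_metric_on ::
    "(real^'n::finite) set \<Rightarrow> (real^'n \<Rightarrow> real^'n \<Rightarrow> real) \<Rightarrow> bool" where
  "finsler_metric_on D F \<longleftrightarrow>
     (\<forall>x\<in>D. \<forall>y. y \<noteq> 0 \<longrightarrow> F x y > 0) \<and>
     smooth_on (D \<times> (- {0})) (\<lambda>(x, y). F x y) \<and>
     (\<forall>x\<in>D. \<forall>y. \<forall>c>0. F x (c *\<^sub>R y) = c * F x y) \<and>
     (\<forall>x\<in>D. \<forall>y. y \<noteq> 0 \<longrightarrow> rank (fundamental_tensor F x y) = CARD('n))"

definition geodesic_spray ::
    "(real^'n::finite \<Rightarrow> real^'n \<Rightarrow> real) \<Rightarrow> real^'n \<Rightarrow> real^'n \<Rightarrow> real^'n" where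
  "geodesic_spray F x y =
     (\<chi> i. 1/4 * (\<Sum>l\<in>UNIV. matrix_inv (fundamental_tensor F x y) $ i $ l *
        ((\<Sum>k\<in>UNIV. y $ k * partial k (\<lambda>z. partial l (\<lambda>w. (F z w)\<^sup>2) y) x)
          - partial l (\<lambda>z. (F z y)\<^sup>2) x)))"

text \<open>
  By the Cauchy-Schwarz inequality only the values of \<open>\<phi>\<close> at points with \<open>\<bar>s\<bar> \<le> r\<close> enter \<open>F\<close>.
  Smoothness of \<open>\<phi>\<close> is asked near these points with \<open>r > 0\<close>, so that its partial derivatives
  are meaningful at \<open>s = r\<close> and \<open>s = - r\<close> too. Smoothness on a whole strip would be too much:
  the cylinder metric given by \<open>\<phi>\<^sup>2 = s\<^sup>2 / r\<^sup>2 + (r\<^sup>2 - s\<^sup>2) / r^4\<close>, which has a parallel 1-form,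
  has \<open>\<phi>\<^sup>2 < 0\<close> for \<open>r < 1\<close> and large \<open>s\<close>.
\<close>

definition spherically_symmetric_on ::
    "real \<Rightarrow> (real^'n::finite) set \<Rightarrow> (real^'n \<Rightarrow> real^'n \<Rightarrow> real) \<Rightarrow> (real \<Rightarrow> real \<Rightarrow> real) \<Rightarrow> bool" where
  "spherically_symmetric_on r\<^sub>0 D F \<phi> \<longleftrightarrow>
     (\<exists>U. open U \<and> {(r, s). 0 < r \<and> r < r\<^sub>0 \<and> \<bar>s\<bar> \<le> r} \<subseteq> U \<and> smooth_on U (\<lambda>(r, s). \<phi> r s)) \<and>
     (\<forall>x\<in>D. \<forall>y. y \<noteq> 0 \<longrightarrow> F x y = norm y * \<phi> (norm x) ((x \<bullet> y) / norm y))"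

definition d_r :: "(real \<Rightarrow> real \<Rightarrow> real) \<Rightarrow> real \<Rightarrow> real \<Rightarrow> real" where
  "d_r \<phi> r s = deriv (\<lambda>t. \<phi> t s) r"

definition d_s :: "(real \<Rightarrow> real \<Rightarrow> real) \<Rightarrow> real \<Rightarrow> real \<Rightarrow> real" where
  "d_s \<phi> r s = deriv (\<lambda>t. \<phi> r t) s"

definition spray_Q :: "(real \<Rightarrow> real \<Rightarrow> real) \<Rightarrow> real \<Rightarrow> real \<Rightarrow> real" where
  "spray_Q \<phi> r s = 1 / (2 * r) *
     ((- d_r \<phi> r s + s * d_s (d_r \<phi>) r s + r * d_s (d_s \<phi>) r s) /
      (\<phi> r s - s * d_s \<phi> r s + (r\<^sup>2 - s\<^sup>2) * d_s (d_s \<phi>) r s))"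

definition spray_P :: "(real \<Rightarrow> real \<Rightarrow> real) \<Rightarrow> real \<Rightarrow> real \<Rightarrow> real" where
  "spray_P \<phi> r s =
     - (spray_Q \<phi> r s / \<phi> r s) * (s * \<phi> r s + (r\<^sup>2 - s\<^sup>2) * d_s \<phi> r s)
     + 1 / (2 * r * \<phi> r s) * (s * d_r \<phi> r s + r * d_s \<phi> r s)"

text \<open>
  The functions \<open>P\<close> and \<open>Q\<close> are considered for \<open>0 < r < r\<^sub>0\<close> and \<open>\<bar>s\<bar> \<le> r\<close>; because of the
  factors \<open>1 / r\<close> they are not defined at the origin.
\<close>

definition spray_determined_by ::
    "real \<Rightarrow> (real^'n::finite) set \<Rightarrow> (real^'n \<Rightarrow> real^'n \<Rightarrow> real) \<Rightarrow> (real \<Rightarrow> real \<Rightarrow> real) \<Rightarrow>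
     (real \<Rightarrow> real \<Rightarrow> real) \<Rightarrow> (real \<Rightarrow> real \<Rightarrow> real) \<Rightarrow> bool" where
  "spray_determined_by r\<^sub>0 D F \<phi> P Q \<longleftrightarrow>
     (\<forall>r s. 0 < r \<and> r < r\<^sub>0 \<and> \<bar>s\<bar> \<le> r \<longrightarrow> P r s = spray_P \<phi> r s \<and> Q r s = spray_Q \<phi> r s) \<and>
     (\<forall>x\<in>D - {0}. \<forall>y. y \<noteq> 0 \<longrightarrow>
        (let r = norm x; u = norm y; s = (x \<bullet> y) / norm y in
          geodesic_spray F x y = (u * P r s) *\<^sub>R y + (u\<^sup>2 * Q r s) *\<^sub>R x))"

text \<open>A 1-form is given by the vector of its components \<open>b\<^sub>i\<close>.\<close>

definition horizontal_derivative ::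
    "(real^'n::finite \<Rightarrow> real^'n \<Rightarrow> real) \<Rightarrow> (real^'n \<Rightarrow> real^'n) \<Rightarrow> 'n \<Rightarrow> 'n \<Rightarrow>
     real^'n \<Rightarrow> real^'n \<Rightarrow> real" where
  "horizontal_derivative F b i j x y =
     partial j (\<lambda>z. b z $ i) x
     - (\<Sum>h\<in>UNIV. partial i (\<lambda>v. partial j (\<lambda>w. geodesic_spray F x w $ h) v) y * b x $ h)"

definition nonzero_parallel_form_on ::
    "(real^'n::finite) set \<Rightarrow> (real^'n \<Rightarrow> real^'n \<Rightarrow> real) \<Rightarrow> (real^'n \<Rightarrow> real^'n) \<Rightarrow> bool" where
  "nonzero_parallel_form_on D F b \<longleftrightarrow>
     smooth_on D b \<and> (\<exists>x\<in>D. b x \<noteq> 0) \<and>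
     (\<forall>x\<in>D. \<forall>y. y \<noteq> 0 \<longrightarrow> (\<forall>i j. horizontal_derivative F b i j x y = 0))"

end

theory Submission
  imports Defs
begin

text \<open>
  Write \<open>r = |x|\<close>, \<open>u = |y|\<close>, \<open>s = \<langle>x, y\<rangle> / |y|\<close>. Collecting the sum over \<open>h\<close> in the covariant
  derivative of \<open>b = f(r) x\<close> shows that, away from the origin, \<open>b\<close> is parallel if and only if
  \<open>f \<delta>\<^sub>i\<^sub>j + (f' / r) x\<^sub>i x\<^sub>j = f \<partial>\<^sup>2 \<langle>x, G\<rangle> / \<partial>y\<^sub>i \<partial>y\<^sub>j\<close>. Only the radial component
  \<open>\<langle>x, G\<rangle> = u\<^sup>2 (s P + r\<^sup>2 Q)\<close> of the spray enters, and the formula for \<open>Q\<close> in the theorem is nothing but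
  \<open>s P + r\<^sup>2 Q = 1/2 + s\<^sup>2 f' / (2 r f)\<close>, that is,
  \<open>\<langle>x, G\<rangle> = |y|\<^sup>2 / 2 + (f' / (2 r f)) \<langle>x, y\<rangle>\<^sup>2\<close>. The Hessian of this quadratic polynomial is
  \<open>\<delta>\<^sub>i\<^sub>j + (f' / (r f)) x\<^sub>i x\<^sub>j\<close>, which gives one direction
  (\<open>spray_determined_imp_parallel\<close>). For the other one, the equation of a parallel form is contracted
  with \<open>y\<close> twice, and \<open>\<langle>x, G\<rangle>\<close> is recovered from its Hessian because it is homogeneous of degree two
  (\<open>parallel_radial_equation\<close>).

  Three points need care. The first is the formula \<open>G = u P y + u\<^sup>2 Q x\<close>
  (\<open>geodesic_spray_formula\<close>): the energy \<open>F\<^sup>2 / 2\<close> is of the form \<open>u\<^sup>2 K(s)\<close>, its Hessian, the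
  fundamental tensor, is an explicit combination of the identity and products of \<open>x\<close> and \<open>y\<close>
  (\<open>hessian_angle_energy\<close>), and the equation defining the spray becomes a pair of linear equations
  for \<open>P\<close> and \<open>Q\<close>; the denominator of \<open>Q\<close> does not vanish since the tensor is nondegenerate
  (\<open>denominator_nonzero\<close>). The second is that the coefficient \<open>f\<close> of a nonzero parallel form has no
  zeros, because for \<open>s = r\<close> it satisfies a linear differential equation
  (\<open>parallel_coefficient_nonzero\<close>). The third is the origin, where a form \<open>f(r) x\<close> would vanish and
  the formulas have no meaning: a spray with the prescribed \<open>Q\<close> is unbounded there, whereas the spray
  of a metric is continuous in \<open>x\<close>, so the origin is not in the domain
  (\<open>spray_determined_imp_origin_removed\<close>).
\<close>

section \<open>The calculus of smooth functions\<close>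

text \<open>Changing a function off the open set \<open>S\<close> may change its Frechet derivatives only at points
  off \<open>S\<close>; the induction has to carry this through the iterated derivatives.\<close>

lemma Ck_on_cong:
  fixes f g :: "'a::euclidean_space \<Rightarrow> 'b::real_normed_vector"
  assumes "open S" "\<And>x. x \<in> S \<Longrightarrow> f x = g x" "Ck_on k S f"
  shows "Ck_on k S g"
  using assms(2,3)
proof (induction k arbitrary: f g)
  case 0
  then show ?case using continuous_on_cong[of S S f g] by simp
next
  case (Suc k)
  have "f differentiable_on S" using Suc.prems(2) by simp
  then have f: "(f has_derivative frechet_derivative f (at x)) (at x)" if "x \<in> S" for x
    using that assms(1) differentiable_on_eq_differentiable_at frechet_derivative_works by blast
  have g: "(g has_derivative frechet_derivative f (at x)) (at x)" if "x \<in> S" for x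
    by (rule has_derivative_transform_within_open[OF f[OF that] assms(1) that Suc.prems(1)])
  have "g differentiable_on S"
    using g by (meson differentiable_at_imp_differentiable_on differentiableI)
  moreover have "Ck_on k S (\<lambda>x. frechet_derivative g (at x) v)" for v
  proof (rule Suc.IH)
    show "Ck_on k S (\<lambda>x. frechet_derivative f (at x) v)" using Suc.prems(2) by simp
    show "frechet_derivative f (at x) v = frechet_derivative g (at x) v" if "x \<in> S" for x
      using frechet_derivative_at[OF g[OF that]] by simp
  qed
  ultimately show ?case by simp
qed

lemma Ck_on_SucI:
  assumes "open S" "\<And>x. x \<in> S \<Longrightarrow> (f has_derivative D x) (at x)" "\<And>v. Ck_on k S (\<lambda>x. D x v)"
  shows "Ck_on (Suc k) S f"
proof -
  have "f differentiable_on S"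
    using assms(2) by (meson differentiable_at_imp_differentiable_on differentiableI)
  moreover have "Ck_on k S (\<lambda>x. frechet_derivative f (at x) v)" for v
  proof (rule Ck_on_cong[OF assms(1) _ assms(3)])
    show "D x v = frechet_derivative f (at x) v" if "x \<in> S" for x
      using frechet_derivative_at[OF assms(2)[OF that]] by simp
  qed
  ultimately show ?thesis by simp
qed

lemma Ck_on_lower: "Ck_on (Suc k) S f \<Longrightarrow> Ck_on k S f"
proof (induction k arbitrary: f)
  case 0
  then show ?case by (simp add: differentiable_imp_continuous_on)
next
  case (Suc k)
  show ?case unfolding Ck_on.simps(2)[of k]
  proof (intro conjI allI)
    show "f differentiable_on S" using Suc.prems by simp
    show "Ck_on k S (\<lambda>x. frechet_derivative f (at x) v)" for v
      using Suc.prems Suc.IH[of "\<lambda>x. frechet_derivative f (at x) v"] by simp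
  qed
qed

lemma Ck_on_has_derivative:
  assumes "open S" "Ck_on (Suc k) S f" "x \<in> S"
  shows "(f has_derivative frechet_derivative f (at x)) (at x)"
proof -
  have "f differentiable_on S" using assms(2) by simp
  then have "f differentiable (at x)" using assms(1,3) differentiable_on_eq_differentiable_at by blast
  then show ?thesis by (simp add: frechet_derivative_works)
qed

lemma Ck_on_subset:
  "open S \<Longrightarrow> open T \<Longrightarrow> T \<subseteq> S \<Longrightarrow> Ck_on k S f \<Longrightarrow> Ck_on k T f"
  by (induction k arbitrary: f) (auto intro: continuous_on_subset differentiable_on_subset)

lemma Ck_on_const: "open S \<Longrightarrow> Ck_on k S (\<lambda>x. c)"
proof (induction k arbitrary: c)
  case (Suc k)
  show ?case
    by (rule Ck_on_SucI[where D = "\<lambda>x v. 0"]) (use Suc in \<open>auto intro: has_derivative_const\<close>)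
qed simp

lemma Ck_on_bounded_linear:
  assumes "bounded_linear h" "open S"
  shows "Ck_on k S h"
proof (cases k)
  case 0
  then show ?thesis using assms by (simp add: linear_continuous_on)
next
  case (Suc m)
  show ?thesis unfolding Suc
    by (rule Ck_on_SucI[where D = "\<lambda>x. h"])
      (use assms in \<open>auto intro: bounded_linear_imp_has_derivative Ck_on_const\<close>)
qed

lemma Ck_on_add:
  assumes "open S" "Ck_on k S f" "Ck_on k S g"
  shows "Ck_on k S (\<lambda>x. f x + g x)"
  using assms(2,3)
proof (induction k arbitrary: f g)
  case 0
  then show ?case by (simp add: continuous_on_add)
next
  case (Suc k)
  show ?case
    by (rule Ck_on_SucI[OF assms(1)
          has_derivative_add[OF Ck_on_has_derivative[OF assms(1) Suc.prems(1)]
            Ck_on_has_derivative[OF assms(1) Suc.prems(2)]]])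
      (use Suc in \<open>auto simp: assms(1)\<close>)
qed

lemma Ck_on_scaleR:
  assumes "open S" "Ck_on k S f" "Ck_on k S g"
  shows "Ck_on k S (\<lambda>x. f x *\<^sub>R g x)"
  using assms(2,3)
proof (induction k arbitrary: f g)
  case 0
  then show ?case by (simp add: continuous_on_scaleR)
next
  case (Suc k)
  note d = has_derivative_scaleR[OF Ck_on_has_derivative[OF assms(1) Suc.prems(1)]
      Ck_on_has_derivative[OF assms(1) Suc.prems(2)]]
  have l: "Ck_on k S f" "Ck_on k S g" using Suc.prems by (auto intro: Ck_on_lower)
  show ?case
    by (rule Ck_on_SucI[OF assms(1) d])
      (use Suc l in \<open>auto simp: assms(1) intro!: Ck_on_add\<close>)
qed

lemma Ck_on_sum:
  assumes "open S" "\<And>i. i \<in> I \<Longrightarrow> Ck_on k S (f i)"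
  shows "Ck_on k S (\<lambda>x. \<Sum>i\<in>I. f i x)"
  using assms(2)
  by (induction I rule: infinite_finite_induct) (auto intro!: Ck_on_add Ck_on_const simp: assms(1))

lemma Ck_on_bounded_linear_compose:
  assumes "open S" "bounded_linear h" "Ck_on k S f"
  shows "Ck_on k S (\<lambda>x. h (f x))"
  using assms(3)
proof (induction k arbitrary: f)
  case 0
  then show ?case by (simp add: bounded_linear.continuous_on[OF assms(2)])
next
  case (Suc k)
  show ?case
    by (rule Ck_on_SucI[OF assms(1) bounded_linear.has_derivative[OF assms(2)
          Ck_on_has_derivative[OF assms(1) Suc.prems]]])
      (use Suc assms(1) in auto)
qed

text \<open>The chain rule, with the differential of the outer function expanded in a basis, writes a
  directional derivative of a composition through compositions of lower order.\<close>

lemma Ck_on_compose: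
  fixes f :: "'b::euclidean_space \<Rightarrow> 'c::real_normed_vector" and h :: "'a::euclidean_space \<Rightarrow> 'b"
  assumes "open S" "open T" "h ` S \<subseteq> T" "Ck_on k T f" "Ck_on k S h"
  shows "Ck_on k S (\<lambda>x. f (h x))"
  using assms(4,5)
proof (induction k arbitrary: f)
  case 0
  then show ?case using assms(3) by (auto intro: continuous_on_compose2)
next
  case (Suc k)
  let ?f' = "\<lambda>x. frechet_derivative f (at (h x))" and ?h' = "\<lambda>x. frechet_derivative h (at x)"
  have hd: "(h has_derivative ?h' x) (at x)" if "x \<in> S" for x
    using Ck_on_has_derivative[OF assms(1) Suc.prems(2) that] .
  have fd: "(f has_derivative ?f' x) (at (h x))" if "x \<in> S" for x
    using Ck_on_has_derivative[OF assms(2) Suc.prems(1)] assms(3) that by blast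
  have lf: "linear (?f' x)" if "x \<in> S" for x
    using fd[OF that] by (rule has_derivative_linear)
  have 1: "((\<lambda>x. f (h x)) has_derivative (\<lambda>v. \<Sum>b\<in>Basis. (?h' x v \<bullet> b) *\<^sub>R ?f' x b)) (at x)"
    if "x \<in> S" for x
  proof -
    have "(\<Sum>b\<in>Basis. (?h' x v \<bullet> b) *\<^sub>R ?f' x b) = ?f' x (?h' x v)" for v
      using linear_sum[OF lf[OF that], of "\<lambda>b. (?h' x v \<bullet> b) *\<^sub>R b" Basis]
      by (simp add: linear_scale[OF lf[OF that]] euclidean_representation)
    then show ?thesis
      using has_derivative_compose[OF hd fd, OF that that] by simp
  qed
  have "Ck_on k S h" using Suc.prems(2) by (rule Ck_on_lower)
  then have f': "Ck_on k S (\<lambda>x. ?f' x b)" for b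
    using Suc.IH[of "\<lambda>z. frechet_derivative f (at z) b"] Suc.prems(1) by simp
  have h': "Ck_on k S (\<lambda>x. ?h' x v \<bullet> b)" for v b
    using Suc.prems(2)
    by (intro Ck_on_bounded_linear_compose[OF assms(1) bounded_linear_inner_left]) simp
  show ?case
    by (rule Ck_on_SucI[OF assms(1) 1])
      (auto intro!: Ck_on_sum Ck_on_scaleR f' h' simp: assms(1))
qed

lemma Ck_on_inverse: "Ck_on k (- {0}) (inverse :: real \<Rightarrow> real)"
proof (induction k)
  case 0
  then show ?case by (auto intro!: continuous_intros)
next
  case (Suc k)
  have o: "open (- {0::real})" by (simp add: open_Compl)
  have "((inverse::real\<Rightarrow>real) has_derivative (\<lambda>v. (- v) *\<^sub>R (inverse x *\<^sub>R inverse x))) (at x)"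
    if "x \<in> - {0}" for x
    using that by (auto intro!: derivative_eq_intros simp: algebra_simps)
  then show ?case
    by (rule Ck_on_SucI[OF o]) (assumption | intro Ck_on_scaleR Ck_on_const Suc o)+
qed

text \<open>The derivative of the norm at \<open>x\<close> is \<open>v \<mapsto> \<langle>v, x\<rangle> / |x|\<close>, which involves the norm once more; hence
  one order of smoothness follows from the previous one.\<close>

lemma Ck_on_norm: "Ck_on k (- {0}) (norm :: 'a::euclidean_space \<Rightarrow> real)"
proof (induction k)
  case 0
  then show ?case by (auto intro!: continuous_intros)
next
  case (Suc k)
  have o: "open (- {0::'a})" by (simp add: open_Compl)
  have d: "((norm::'a\<Rightarrow>real) has_derivative (\<lambda>v. (v \<bullet> x) *\<^sub>R inverse (norm x))) (at x)"
    if "x \<in> - {0}" for x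
    using has_derivative_norm[of x] that by (simp add: sgn_div_norm inner_commute mult.commute)
  have i: "Ck_on k (- {0::'a}) (\<lambda>x. inverse (norm x))"
    by (rule Ck_on_compose[OF o _ _ Ck_on_inverse Suc]) auto
  show ?case
    by (rule Ck_on_SucI[OF o d])
      (intro Ck_on_scaleR i o Ck_on_bounded_linear bounded_linear_inner_right | assumption)+
qed

lemma smooth_on_lower: "smooth_on S f \<Longrightarrow> Ck_on k S f"
  by (simp add: smooth_on_def)

lemma smooth_on_cong:
  "open S \<Longrightarrow> smooth_on S f \<Longrightarrow> (\<And>x. x \<in> S \<Longrightarrow> f x = g x) \<Longrightarrow> smooth_on S g"
  unfolding smooth_on_def using Ck_on_cong by metis

lemma smooth_on_subset: "smooth_on S f \<Longrightarrow> open S \<Longrightarrow> open T \<Longrightarrow> T \<subseteq> S \<Longrightarrow> smooth_on T f"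
  unfolding smooth_on_def using Ck_on_subset by metis

lemma smooth_on_const: "open S \<Longrightarrow> smooth_on S (\<lambda>x. c)"
  and smooth_on_bounded_linear: "bounded_linear h \<Longrightarrow> open S \<Longrightarrow> smooth_on S h"
  and smooth_on_add: "open S \<Longrightarrow> smooth_on S f \<Longrightarrow> smooth_on S g \<Longrightarrow> smooth_on S (\<lambda>x. f x + g x)"
  and smooth_on_scaleR:
    "open S \<Longrightarrow> smooth_on S a \<Longrightarrow> smooth_on S g \<Longrightarrow> smooth_on S (\<lambda>x. a x *\<^sub>R g x)"
  by (simp_all add: smooth_on_def Ck_on_const Ck_on_bounded_linear Ck_on_add Ck_on_scaleR)

lemma smooth_on_mult:
  fixes f g :: "'a::euclidean_space \<Rightarrow> real"
  shows "open S \<Longrightarrow> smooth_on S f \<Longrightarrow> smooth_on S g \<Longrightarrow> smooth_on S (\<lambda>x. f x * g x)"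
  using smooth_on_scaleR[of S f g] by simp

lemma smooth_on_minus: "open S \<Longrightarrow> smooth_on S f \<Longrightarrow> smooth_on S (\<lambda>x. - f x)"
  using smooth_on_scaleR[OF _ smooth_on_const[of S "- 1 :: real"], of f] by simp

lemma smooth_on_diff:
  "open S \<Longrightarrow> smooth_on S f \<Longrightarrow> smooth_on S g \<Longrightarrow> smooth_on S (\<lambda>x. f x - g x)"
  using smooth_on_add[of S f "\<lambda>x. - g x"] smooth_on_minus[of S g] by simp

lemma smooth_on_power:
  fixes f :: "'a::euclidean_space \<Rightarrow> real"
  shows "open S \<Longrightarrow> smooth_on S f \<Longrightarrow> smooth_on S (\<lambda>x. f x ^ m)"
  by (induction m) (auto intro: smooth_on_const smooth_on_mult)

lemma smooth_on_compose:
  fixes f :: "'b::euclidean_space \<Rightarrow> 'c::real_normed_vector" and h :: "'a::euclidean_space \<Rightarrow> 'b"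
  shows "open S \<Longrightarrow> open T \<Longrightarrow> smooth_on T f \<Longrightarrow> smooth_on S h \<Longrightarrow> (\<And>x. x \<in> S \<Longrightarrow> h x \<in> T) \<Longrightarrow>
    smooth_on S (\<lambda>x. f (h x))"
  unfolding smooth_on_def using Ck_on_compose[of S T h _ f] by blast

lemma smooth_on_norm: "smooth_on (- {0}) (norm :: 'a::euclidean_space \<Rightarrow> real)"
  by (simp add: smooth_on_def Ck_on_norm)

lemma smooth_on_divide:
  fixes f g :: "'a::euclidean_space \<Rightarrow> real"
  assumes "open S" "smooth_on S f" "smooth_on S g" "\<And>x. x \<in> S \<Longrightarrow> g x \<noteq> 0"
  shows "smooth_on S (\<lambda>x. f x / g x)"
proof -
  have "smooth_on (- {0}) (inverse :: real \<Rightarrow> real)" by (simp add: smooth_on_def Ck_on_inverse)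
  then have "smooth_on S (\<lambda>x. inverse (g x))"
    by (rule smooth_on_compose[rotated 2]) (use assms in auto)
  then show ?thesis
    using smooth_on_mult[OF assms(1,2)] by (simp add: divide_inverse)
qed

lemma smooth_on_imp_continuous_on: "smooth_on S f \<Longrightarrow> continuous_on S f"
  using smooth_on_lower[of S f 0] by simp

lemma smooth_on_has_derivative:
  "smooth_on S f \<Longrightarrow> open S \<Longrightarrow> x \<in> S \<Longrightarrow> (f has_derivative frechet_derivative f (at x)) (at x)"
  using Ck_on_has_derivative[of S 0 f x] smooth_on_lower[of S f "Suc 0"] by blast

lemma smooth_on_frechet_derivative:
  assumes "smooth_on S f"
  shows "smooth_on S (\<lambda>x. frechet_derivative f (at x) v)"
  unfolding smooth_on_def
proof
  fix k show "Ck_on k S (\<lambda>x. frechet_derivative f (at x) v)"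
    using smooth_on_lower[OF assms, of "Suc k"] by simp
qed

lemma smooth_on_Pair:
  fixes f :: "'a::euclidean_space \<Rightarrow> 'b::euclidean_space" and g :: "'a \<Rightarrow> 'c::euclidean_space"
  assumes "open S" "smooth_on S f" "smooth_on S g"
  shows "smooth_on S (\<lambda>x. (f x, g x))"
proof -
  have "bounded_linear (\<lambda>z::'b. (z, 0::'c))" "bounded_linear (\<lambda>z::'c. (0::'b, z))"
    by (auto intro: bounded_linear_Pair bounded_linear_ident bounded_linear_zero)
  then have "smooth_on S (\<lambda>x. (f x, 0) + (0, g x))"
    using assms by (intro smooth_on_add)
      (auto simp: smooth_on_def intro: Ck_on_bounded_linear_compose)
  then show ?thesis by simp
qed

lemma smooth_on_has_real_derivative:
  fixes f :: "real \<Rightarrow> real"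
  assumes "smooth_on S f" "open S" "x \<in> S"
  shows "(f has_real_derivative deriv f x) (at x)"
  using smooth_on_has_derivative[OF assms]
  by (metis DERIV_deriv_iff_real_differentiable differentiable_def)

lemma smooth_on_deriv:
  fixes f :: "real \<Rightarrow> real"
  assumes "smooth_on S f" "open S"
  shows "smooth_on S (deriv f)"
proof (rule smooth_on_cong[OF assms(2) smooth_on_frechet_derivative[OF assms(1), of 1]])
  fix x assume "x \<in> S"
  from smooth_on_has_real_derivative[OF assms this]
  show "frechet_derivative f (at x) 1 = deriv f x"
    unfolding has_field_derivative_def by (simp flip: frechet_derivative_at)
qed

lemmas smooth_on_intros = smooth_on_const smooth_on_add smooth_on_diff smooth_on_minus
  smooth_on_mult smooth_on_divide smooth_on_power smooth_on_scaleR

section \<open>Partial derivatives\<close>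

text \<open>A partial derivative is defined through \<open>deriv\<close>, which carries no information at points where
  the derivative does not exist. All rules for it therefore go through the Frechet derivative.\<close>

lemma has_derivative_imp_partial:
  assumes "(f has_derivative f') (at x)"
  shows "partial i f x = f' (axis i 1)"
proof -
  have "((\<lambda>t::real. x + t *\<^sub>R axis i 1) has_derivative (\<lambda>t. t *\<^sub>R axis i 1)) (at 0)"
    by (auto intro!: derivative_eq_intros)
  from has_derivative_compose[OF this, of f f'] assms
  have "((\<lambda>t. f (x + t *\<^sub>R axis i 1)) has_derivative (\<lambda>t. f' (t *\<^sub>R axis i 1))) (at 0)"
    by simp
  moreover have "(\<lambda>t. f' (t *\<^sub>R axis i 1)) = (*) (f' (axis i 1))"
    using linear_scale[OF has_derivative_linear[OF assms]] by (auto simp: mult.commute)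
  ultimately show ?thesis
    unfolding partial_def by (simp add: DERIV_imp_deriv has_field_derivative_def)
qed

text \<open>Formulas for the metric hold for \<open>y \<noteq> 0\<close> only, and are to be differentiated twice; this
  permits to substitute them under a partial derivative.\<close>

lemma partial_cong:
  assumes "open S" "x \<in> S" "\<And>z. z \<in> S \<Longrightarrow> f z = g z"
  shows "partial i f x = partial i g x"
proof -
  have "((\<lambda>t::real. x + t *\<^sub>R axis i 1) \<longlongrightarrow> x + 0 *\<^sub>R axis i 1) (nhds 0)"
    by (intro tendsto_intros filterlim_ident)
  then have "((\<lambda>t::real. x + t *\<^sub>R axis i 1) \<longlongrightarrow> x) (nhds 0)" by simp
  then have "\<forall>\<^sub>F t in nhds (0::real). x + t *\<^sub>R axis i 1 \<in> S"
    using assms(1,2) topological_tendstoD by blast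
  then have "\<forall>\<^sub>F t in nhds (0::real). f (x + t *\<^sub>R axis i 1) = g (x + t *\<^sub>R axis i 1)"
    by eventually_elim (rule assms(3))
  then show ?thesis unfolding partial_def by (rule deriv_cong_ev) simp
qed

lemma smooth_on_partial:
  assumes "smooth_on S f" "open S"
  shows "smooth_on S (partial i f)"
  by (rule smooth_on_cong[OF assms(2) smooth_on_frechet_derivative[OF assms(1), of "axis i 1"]])
    (metis assms has_derivative_imp_partial smooth_on_has_derivative)

lemma partial_sum_right:
  assumes "open S" "x \<in> S" "\<And>h. smooth_on S (f h)"
  shows "partial i (\<lambda>z. \<Sum>h\<in>H. f h z * c h) x = (\<Sum>h\<in>H. partial i (f h) x * c h)"
proof -
  note d = smooth_on_has_derivative[OF assms(3,1,2)]
  have "((\<lambda>z. \<Sum>h\<in>H. f h z * c h) has_derivative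
      (\<lambda>v. \<Sum>h\<in>H. frechet_derivative (f h) (at x) v * c h)) (at x)"
    by (intro has_derivative_sum has_derivative_mult_left d)
  then show ?thesis
    using has_derivative_imp_partial d by (metis (no_types, lifting) sum.cong)
qed

lemma smooth_on_partial_snd:
  fixes H :: "'a::euclidean_space \<times> (real^'n::finite) \<Rightarrow> real"
  assumes "smooth_on S H" "open S"
  shows "smooth_on S (\<lambda>p. partial j (\<lambda>w. H (fst p, w)) (snd p))"
proof (rule smooth_on_cong[OF assms(2) smooth_on_frechet_derivative[OF assms(1), of "(0, axis j 1)"]])
  fix p assume "p \<in> S"
  have "((\<lambda>w. (fst p, w)) has_derivative (\<lambda>v. (0, v))) (at (snd p))"
    by (auto intro!: derivative_eq_intros)
  moreover have "(H has_derivative frechet_derivative H (at p)) (at (fst p, snd p))"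
    using smooth_on_has_derivative[OF assms \<open>p \<in> S\<close>] by simp
  ultimately show "frechet_derivative H (at p) (0, axis j 1) = partial j (\<lambda>w. H (fst p, w)) (snd p)"
    using has_derivative_imp_partial[OF has_derivative_compose] by metis
qed

lemma smooth_on_partial_fst:
  fixes H :: "(real^'n::finite) \<times> 'a::euclidean_space \<Rightarrow> real"
  assumes "smooth_on S H" "open S"
  shows "smooth_on S (\<lambda>p. partial j (\<lambda>z. H (z, snd p)) (fst p))"
proof (rule smooth_on_cong[OF assms(2) smooth_on_frechet_derivative[OF assms(1), of "(axis j 1, 0)"]])
  fix p assume "p \<in> S"
  have "((\<lambda>w. (w, snd p)) has_derivative (\<lambda>v. (v, 0))) (at (fst p))"
    by (auto intro!: derivative_eq_intros)
  moreover have "(H has_derivative frechet_derivative H (at p)) (at (fst p, snd p))"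
    using smooth_on_has_derivative[OF assms \<open>p \<in> S\<close>] by simp
  ultimately show "frechet_derivative H (at p) (axis j 1, 0) = partial j (\<lambda>z. H (z, snd p)) (fst p)"
    using has_derivative_imp_partial[OF has_derivative_compose] by metis
qed

lemma sum_partial_eq_directional:
  assumes "(f has_derivative f') (at x)"
  shows "(\<Sum>k\<in>UNIV. y $ k * partial k f x) = f' y"
proof -
  have l: "linear f'" using assms by (rule has_derivative_linear)
  have "f' y = f' (\<Sum>k\<in>UNIV. y $ k *\<^sub>R axis k 1)"
    using basis_expansion[of y] by (simp add: scalar_mult_eq_scaleR)
  also have "\<dots> = (\<Sum>k\<in>UNIV. y $ k * f' (axis k 1))"
    by (simp add: linear_sum[OF l] linear_scale[OF l])
  finally show ?thesis by (simp add: has_derivative_imp_partial[OF assms])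
qed

section \<open>Functions of two real variables\<close>

lemma smooth_on_prod_has_derivative:
  fixes \<phi> :: "real \<Rightarrow> real \<Rightarrow> real"
  assumes "smooth_on U (\<lambda>(r, s). \<phi> r s)" "open U" "(r, s) \<in> U"
  shows "((\<lambda>(r, s). \<phi> r s) has_derivative (\<lambda>(a, b). a * d_r \<phi> r s + b * d_s \<phi> r s)) (at (r, s))"
    and "((\<lambda>t. \<phi> t s) has_real_derivative d_r \<phi> r s) (at r)"
    and "((\<lambda>t. \<phi> r t) has_real_derivative d_s \<phi> r s) (at s)"
proof -
  let ?D = "frechet_derivative (\<lambda>(r, s). \<phi> r s) (at (r, s))"
  note D = smooth_on_has_derivative[OF assms]
  have l: "linear ?D" using D by (rule has_derivative_linear)
  have lin: "?D (a, b) = a * ?D (1, 0) + b * ?D (0, 1)" for a b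
    using linear_add[OF l, of "a *\<^sub>R (1, 0)" "b *\<^sub>R (0, 1)"] by (simp add: linear_scale[OF l] del: scaleR_Pair) (simp)
  have "((\<lambda>t. (t, s)) has_derivative (\<lambda>t. (t, 0))) (at r)"
    by (auto intro!: derivative_eq_intros)
  from has_derivative_compose[OF this D] have "((\<lambda>t. \<phi> t s) has_derivative (\<lambda>t. ?D (t, 0))) (at r)"
    by simp
  moreover have "(\<lambda>t. ?D (t, 0)) = (*) (?D (1, 0))" by (rule ext, subst lin) (simp add: mult.commute)
  ultimately have r: "((\<lambda>t. \<phi> t s) has_real_derivative ?D (1, 0)) (at r)"
    by (simp add: has_field_derivative_def)
  have "((\<lambda>t. (r, t)) has_derivative (\<lambda>t. (0, t))) (at s)"
    by (auto intro!: derivative_eq_intros)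
  from has_derivative_compose[OF this D] have "((\<lambda>t. \<phi> r t) has_derivative (\<lambda>t. ?D (0, t))) (at s)"
    by simp
  moreover have "(\<lambda>t. ?D (0, t)) = (*) (?D (0, 1))" by (rule ext, subst lin) (simp add: mult.commute)
  ultimately have s: "((\<lambda>t. \<phi> r t) has_real_derivative ?D (0, 1)) (at s)"
    by (simp add: has_field_derivative_def)
  have e: "?D (1, 0) = d_r \<phi> r s" "?D (0, 1) = d_s \<phi> r s"
    unfolding d_r_def d_s_def using r s by (simp_all add: DERIV_imp_deriv)
  show "((\<lambda>t. \<phi> t s) has_real_derivative d_r \<phi> r s) (at r)"
    and "((\<lambda>t. \<phi> r t) has_real_derivative d_s \<phi> r s) (at s)"
    using r s by (simp_all add: e)
  have "?D = (\<lambda>(a, b). a * d_r \<phi> r s + b * d_s \<phi> r s)" using lin by (auto simp: e)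
  then show "((\<lambda>(r, s). \<phi> r s) has_derivative (\<lambda>(a, b). a * d_r \<phi> r s + b * d_s \<phi> r s)) (at (r, s))"
    using D by simp
qed

lemma smooth_on_d_r_d_s:
  assumes "smooth_on U (\<lambda>(r, s). \<phi> r s)" "open U"
  shows "smooth_on U (\<lambda>(r, s). d_r \<phi> r s)" and "smooth_on U (\<lambda>(r, s). d_s \<phi> r s)"
proof -
  have e: "frechet_derivative (\<lambda>(r, s). \<phi> r s) (at p) = (\<lambda>(a, b). a * d_r \<phi> (fst p) (snd p) + b * d_s \<phi> (fst p) (snd p))"
    if "p \<in> U" for p
    using frechet_derivative_at[OF smooth_on_prod_has_derivative(1)[OF assms, of "fst p" "snd p"]] that by simp
  show "smooth_on U (\<lambda>(r, s). d_r \<phi> r s)"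
    by (rule smooth_on_cong[OF assms(2) smooth_on_frechet_derivative[OF assms(1), of "(1, 0)"]])
      (auto simp: e)
  show "smooth_on U (\<lambda>(r, s). d_s \<phi> r s)"
    by (rule smooth_on_cong[OF assms(2) smooth_on_frechet_derivative[OF assms(1), of "(0, 1)"]])
      (auto simp: e)
qed

text \<open>The second difference over a square equals a mixed derivative somewhere in the square: the mean
  value theorem is applied first to \<open>t \<mapsto> \<phi> t (s + h) - \<phi> t s\<close> and then in the second variable.\<close>

lemma second_difference_mean_value:
  fixes \<phi> A B :: "real \<Rightarrow> real \<Rightarrow> real"
  assumes "0 < h"
    and "\<And>r' s'. r' \<in> {r..r + h} \<Longrightarrow> s' \<in> {s..s + h} \<Longrightarrow>
      ((\<lambda>t. \<phi> t s') has_real_derivative A r' s') (at r')"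
    and "\<And>r' s'. r' \<in> {r..r + h} \<Longrightarrow> s' \<in> {s..s + h} \<Longrightarrow>
      ((\<lambda>t. A r' t) has_real_derivative B r' s') (at s')"
  obtains \<xi> \<eta> where "\<xi> \<in> {r..r + h}" "\<eta> \<in> {s..s + h}"
    "\<phi> (r + h) (s + h) - \<phi> (r + h) s - \<phi> r (s + h) + \<phi> r s = h * (h * B \<xi> \<eta>)"
proof -
  have "\<exists>z>r. z < r + h \<and> (\<phi> (r + h) (s + h) - \<phi> (r + h) s) - (\<phi> r (s + h) - \<phi> r s) =
      (r + h - r) * (A z (s + h) - A z s)"
    by (rule MVT2) (use assms in \<open>auto intro!: DERIV_diff\<close>)
  then obtain \<xi> where "r < \<xi>" "\<xi> < r + h"
    "(\<phi> (r + h) (s + h) - \<phi> (r + h) s) - (\<phi> r (s + h) - \<phi> r s) =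
      (r + h - r) * (A \<xi> (s + h) - A \<xi> s)"
    by blast
  then have \<xi>: "\<xi> \<in> {r..r + h}"
    "(\<phi> (r + h) (s + h) - \<phi> (r + h) s) - (\<phi> r (s + h) - \<phi> r s) = h * (A \<xi> (s + h) - A \<xi> s)"
    by simp_all
  have "\<exists>z>s. z < s + h \<and> A \<xi> (s + h) - A \<xi> s = (s + h - s) * B \<xi> z"
    by (rule MVT2) (use assms \<xi>(1) in auto)
  then obtain \<eta> where "s < \<eta>" "\<eta> < s + h" "A \<xi> (s + h) - A \<xi> s = (s + h - s) * B \<xi> \<eta>"
    by blast
  then have \<eta>: "\<eta> \<in> {s..s + h}" "A \<xi> (s + h) - A \<xi> s = h * B \<xi> \<eta>"
    by simp_all
  show thesis using that[OF \<xi>(1) \<eta>(1)] \<xi>(2) \<eta>(2) by (simp add: algebra_simps)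
qed

text \<open>Schwarz's theorem. The second difference is symmetric in the two variables, so in every small
  square the two mixed derivatives have a common value, possibly at different points. Continuity of
  both excludes that they differ at the corner. It is needed because the spray coefficients
  differentiate the metric in \<open>y\<close> before \<open>x\<close>, whereas \<open>Q\<close> is written with \<open>\<phi>\<^sub>r\<^sub>s\<close>.\<close>

lemma mixed_partials_commute:
  fixes \<phi> :: "real \<Rightarrow> real \<Rightarrow> real"
  assumes \<phi>: "smooth_on U (\<lambda>(r, s). \<phi> r s)" and U: "open U" "(r, s) \<in> U"
  shows "d_r (d_s \<phi>) r s = d_s (d_r \<phi>) r s"
proof (rule ccontr)
  assume ne: "d_r (d_s \<phi>) r s \<noteq> d_s (d_r \<phi>) r s"
  let ?A = "\<lambda>p. d_r (d_s \<phi>) (fst p) (snd p)" and ?B = "\<lambda>p. d_s (d_r \<phi>) (fst p) (snd p)"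
  define \<epsilon> where "\<epsilon> = \<bar>?A (r, s) - ?B (r, s)\<bar> / 2"
  have "\<epsilon> > 0" using ne by (simp add: \<epsilon>_def)
  note sm = smooth_on_d_r_d_s[OF \<phi> U(1)]
  have "continuous_on U ?A" "continuous_on U ?B"
    using smooth_on_d_r_d_s(1)[OF sm(2) U(1)] smooth_on_d_r_d_s(2)[OF sm(1) U(1)]
    by (auto simp: case_prod_beta dest: smooth_on_imp_continuous_on)
  then have c: "continuous (at (r, s)) ?A" "continuous (at (r, s)) ?B"
    using U continuous_on_eq_continuous_at by blast+
  obtain e1 where e1: "e1 > 0" "\<And>p. dist p (r, s) < e1 \<Longrightarrow> dist (?A p) (?A (r, s)) < \<epsilon>"
    using c(1) \<open>\<epsilon> > 0\<close> unfolding continuous_at by (metis (lifting) continuous_at_eps_delta c(1))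
  obtain e2 where e2: "e2 > 0" "\<And>p. dist p (r, s) < e2 \<Longrightarrow> dist (?B p) (?B (r, s)) < \<epsilon>"
    using c(2) \<open>\<epsilon> > 0\<close> by (metis (lifting) continuous_at_eps_delta)
  obtain e3 where e3: "e3 > 0" "\<And>p. dist p (r, s) < e3 \<Longrightarrow> p \<in> U"
    using U unfolding open_dist by blast
  \<comment> \<open>A corner of the square has distance at most \<open>2 * h\<close> from \<open>(r, s)\<close>.\<close>
  define h where "h = min e1 (min e2 e3) / 3"
  have h: "h > 0" "2 * h < e1" "2 * h < e2" "2 * h < e3" using e1(1) e2(1) e3(1) by (auto simp: h_def)
  have near: "dist (r', s') (r, s) \<le> 2 * h" if "r' \<in> {r..r + h}" "s' \<in> {s..s + h}" for r' s'
  proof -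
    have "dist (r', s') (r, s) \<le> \<bar>r' - r\<bar> + \<bar>s' - s\<bar>"
      unfolding dist_Pair_Pair dist_real_def by (simp add: sqrt_sum_squares_le_sum_abs)
    then show ?thesis using that by auto
  qed
  have inU: "(r', s') \<in> U" if "r' \<in> {r..r + h}" "s' \<in> {s..s + h}" for r' s'
    using near[OF that] h e3(2) by fastforce
  obtain \<xi> \<eta> where 1: "\<xi> \<in> {r..r + h}" "\<eta> \<in> {s..s + h}"
    "\<phi> (r + h) (s + h) - \<phi> (r + h) s - \<phi> r (s + h) + \<phi> r s = h * (h * ?B (\<xi>, \<eta>))"
    by (rule second_difference_mean_value[OF h(1), of r s \<phi> "d_r \<phi>" "d_s (d_r \<phi>)"])
      (auto intro!: smooth_on_prod_has_derivative(2)[OF \<phi> U(1)] smooth_on_prod_has_derivative(3)[OF sm(1) U(1)] inU)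
  obtain \<eta>' \<xi>' where 2: "\<eta>' \<in> {s..s + h}" "\<xi>' \<in> {r..r + h}"
    "\<phi> (r + h) (s + h) - \<phi> r (s + h) - \<phi> (r + h) s + \<phi> r s = h * (h * ?A (\<xi>', \<eta>'))"
    by (rule second_difference_mean_value[OF h(1), of s r "\<lambda>s r. \<phi> r s" "\<lambda>s r. d_s \<phi> r s" "\<lambda>s r. d_r (d_s \<phi>) r s"])
      (auto intro!: smooth_on_prod_has_derivative(3)[OF \<phi> U(1)] smooth_on_prod_has_derivative(2)[OF sm(2) U(1)] inU)
  have "h * (h * ?B (\<xi>, \<eta>)) = h * (h * ?A (\<xi>', \<eta>'))" using 1(3) 2(3) by linarith
  then have "?B (\<xi>, \<eta>) = ?A (\<xi>', \<eta>')" using h(1) by simp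
  moreover have "dist (?A (\<xi>', \<eta>')) (?A (r, s)) < \<epsilon>"
    by (rule e1(2)) (use near[OF 2(2,1)] h in linarith)
  moreover have "dist (?B (\<xi>, \<eta>)) (?B (r, s)) < \<epsilon>"
    by (rule e2(2)) (use near[OF 1(1,2)] h in linarith)
  ultimately show False by (simp add: \<epsilon>_def dist_real_def abs_if split: if_splits)
qed

section \<open>The Hessian of a function \<open>|y|\<^sup>2 K(s)\<close>\<close>

lemma has_derivative_norm_scaled_inner:
  fixes x y :: "'a::euclidean_space"
  assumes "y \<noteq> 0"
  shows "((\<lambda>w. (x \<bullet> w) / norm w) has_derivative
    (\<lambda>v. (x \<bullet> v) / norm y - (x \<bullet> y) / norm y * (y \<bullet> v) / (norm y)\<^sup>2)) (at y)"
  using assms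
  by (auto intro!: derivative_eq_intros has_derivative_norm
      simp: sgn_div_norm divide_simps power2_eq_square inner_commute)

lemma has_derivative_angle_function:
  fixes x y :: "'a::euclidean_space"
  assumes "y \<noteq> 0" "(K has_real_derivative k) (at ((x \<bullet> y) / norm y))"
  shows "((\<lambda>w. K ((x \<bullet> w) / norm w)) has_derivative
    (\<lambda>v. ((x \<bullet> v) / norm y - (x \<bullet> y) / norm y * (y \<bullet> v) / (norm y)\<^sup>2) * k)) (at y)"
  using DERIV_compose_FDERIV[OF assms(2) has_derivative_norm_scaled_inner[OF assms(1)]] .

lemma partial_angle_energy:
  fixes x y :: "real^'n::finite"
  assumes "y \<noteq> 0" "(K has_real_derivative k) (at ((x \<bullet> y) / norm y))"
  shows "partial j (\<lambda>w. (norm w)\<^sup>2 * K ((x \<bullet> w) / norm w)) y =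
    (2 * K ((x \<bullet> y) / norm y) - (x \<bullet> y) / norm y * k) * y $ j + norm y * k * x $ j"
proof -
  have "((\<lambda>w. (w \<bullet> w) * K ((x \<bullet> w) / norm w)) has_derivative
     (\<lambda>v. (y \<bullet> y) * (((x \<bullet> v) / norm y - (x \<bullet> y) / norm y * (y \<bullet> v) / (norm y)\<^sup>2) * k)
       + (2 * (y \<bullet> v)) * K ((x \<bullet> y) / norm y))) (at y)"
    by (rule derivative_eq_intros has_derivative_angle_function[OF assms] | simp add: inner_commute)+
  from has_derivative_imp_partial[OF this, of j]
  have "partial j (\<lambda>w. (norm w)\<^sup>2 * K ((x \<bullet> w) / norm w)) y =
    (norm y)\<^sup>2 * ((x $ j / norm y - (x \<bullet> y) / norm y * y $ j / (norm y)\<^sup>2) * k)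
       + (2 * y $ j) * K ((x \<bullet> y) / norm y)"
    by (simp only: dot_square_norm inner_axis inner_real_def mult_1_right)
  also have "\<dots> = (2 * K ((x \<bullet> y) / norm y) - (x \<bullet> y) / norm y * k) * y $ j + norm y * k * x $ j"
    using assms(1) by (simp add: field_simps power2_eq_square)
  finally show ?thesis .
qed

text \<open>The two functions of \<open>y\<close> whose second derivatives matter have the form \<open>|y|\<^sup>2 K(s)\<close> with
  \<open>s = \<langle>x, y\<rangle> / |y|\<close>: the energy \<open>F\<^sup>2 / 2\<close> with \<open>K = \<phi>\<^sup>2 / 2\<close>, and the radial component
  \<open>\<langle>x, G\<rangle>\<close> of the spray with \<open>K = s P + r\<^sup>2 Q\<close>. With \<open>e = y / |y|\<close> and \<open>\<xi> = x - s e\<close>, which is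
  orthogonal to \<open>y\<close> and is \<open>|y|\<close> times the gradient of \<open>s\<close>, the Hessian is
  \<open>(2 K - s K') I + K' (x e\<^sup>T + e x\<^sup>T - s e e\<^sup>T) + K'' \<xi> \<xi>\<^sup>T\<close>.\<close>

lemma hessian_angle_energy:
  fixes x y :: "real^'n::finite"
  assumes "y \<noteq> 0"
    and K: "\<And>v::real^'n. v \<noteq> 0 \<Longrightarrow> (K has_real_derivative K' ((x \<bullet> v) / norm v)) (at ((x \<bullet> v) / norm v))"
    and K': "(K' has_real_derivative k) (at ((x \<bullet> y) / norm y))"
  defines "u \<equiv> norm y" and "s \<equiv> (x \<bullet> y) / norm y"
  shows "partial i (\<lambda>v. partial j (\<lambda>w. (norm w)\<^sup>2 * K ((x \<bullet> w) / norm w)) v) y =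
    (2 * K s - s * K' s) * (if i = j then 1 else 0)
    + K' s * (x $ i * y $ j / u + y $ i * x $ j / u - s * y $ i * y $ j / u\<^sup>2)
    + k * (x $ i - s * y $ i / u) * (x $ j - s * y $ j / u)"
proof -
  have "u > 0" using assms(1) by (simp add: u_def)
  have "partial i (\<lambda>v. partial j (\<lambda>w. (norm w)\<^sup>2 * K ((x \<bullet> w) / norm w)) v) y =
    partial i (\<lambda>v. (2 * K ((x \<bullet> v) / norm v) - (x \<bullet> v) / norm v * K' ((x \<bullet> v) / norm v)) * v $ j
       + norm v * K' ((x \<bullet> v) / norm v) * x $ j) y"
  proof (rule partial_cong[of "- {0}"])
    show "partial j (\<lambda>w. (norm w)\<^sup>2 * K ((x \<bullet> w) / norm w)) v =
      (2 * K ((x \<bullet> v) / norm v) - (x \<bullet> v) / norm v * K' ((x \<bullet> v) / norm v)) * v $ j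
       + norm v * K' ((x \<bullet> v) / norm v) * x $ j" if "v \<in> - {0}" for v
      using that by (intro partial_angle_energy K) auto
  qed (use assms(1) in \<open>auto simp: open_Compl\<close>)
  also have "\<dots> = (2 * K s - s * K' s) * (if i = j then 1 else 0) +
       (2 * ((x $ i / u - s * y $ i / u\<^sup>2) * K' s)
         - (s * ((x $ i / u - s * y $ i / u\<^sup>2) * k) + (x $ i / u - s * y $ i / u\<^sup>2) * K' s)) * y $ j
     + (u * ((x $ i / u - s * y $ i / u\<^sup>2) * k) + y $ i / u * K' s) * x $ j"
  proof -
    let ?\<sigma> = "\<lambda>v. (x \<bullet> v) / u - s * (y \<bullet> v) / u\<^sup>2"
    note d = has_derivative_norm_scaled_inner[OF assms(1), of x] has_derivative_angle_function[OF assms(1) K[OF assms(1)]]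
      has_derivative_angle_function[OF assms(1) K'] has_derivative_norm[OF assms(1)]
    have "((\<lambda>v. (2 * K ((x \<bullet> v) / norm v) - (x \<bullet> v) / norm v * K' ((x \<bullet> v) / norm v)) * v $ j
       + norm v * K' ((x \<bullet> v) / norm v) * x $ j) has_derivative
       (\<lambda>v. ((2 * K s - s * K' s) * v $ j + (2 * (?\<sigma> v * K' s) - (s * (?\<sigma> v * k) + ?\<sigma> v * K' s)) * y $ j)
         + (u * (?\<sigma> v * k) + (v \<bullet> sgn y) * K' s) * x $ j)) (at y)"
      unfolding u_def s_def
      by (intro has_derivative_add has_derivative_mult has_derivative_mult_left has_derivative_diff
          has_derivative_mult_right d bounded_linear.has_derivative[OF bounded_linear_vec_nth] has_derivative_ident)
    note has_derivative_imp_partial[OF this, of i]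
    moreover have "(axis i 1 :: real^'n) $ j = (if i = j then 1 else 0)" by (simp add: axis_def)
    ultimately show ?thesis
      by (simp add: inner_axis inner_axis' sgn_div_norm u_def[symmetric] divide_inverse_commute)
  qed
  also have "\<dots> = (2 * K s - s * K' s) * (if i = j then 1 else 0)
    + K' s * (x $ i * y $ j / u + y $ i * x $ j / u - s * y $ i * y $ j / u\<^sup>2)
    + k * (x $ i - s * y $ i / u) * (x $ j - s * y $ j / u)"
    using \<open>u > 0\<close> by (simp add: field_simps power2_eq_square)
  finally show ?thesis .
qed

text \<open>This is Euler's relation for a function that is homogeneous of degree two. Here it can be read
  off the explicit Hessian.\<close>

lemma hessian_angle_energy_quadratic_form:
  fixes x y :: "real^'n::finite"
  assumes "y \<noteq> 0"
    and "\<And>v::real^'n. v \<noteq> 0 \<Longrightarrow> (K has_real_derivative K' ((x \<bullet> v) / norm v)) (at ((x \<bullet> v) / norm v))"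
    and "(K' has_real_derivative k) (at ((x \<bullet> y) / norm y))"
  shows "(\<Sum>i\<in>UNIV. y $ i * (\<Sum>j\<in>UNIV. y $ j *
      partial i (\<lambda>v. partial j (\<lambda>w. (norm w)\<^sup>2 * K ((x \<bullet> w) / norm w)) v) y)) =
    2 * (norm y)\<^sup>2 * K ((x \<bullet> y) / norm y)"
proof -
  define u s where "u = norm y" and "s = (x \<bullet> y) / norm y"
  have "u > 0" using assms(1) by (simp add: u_def)
  have "y \<bullet> y = u\<^sup>2" "x \<bullet> y = s * u" using assms(1) by (auto simp: u_def s_def dot_square_norm)
  then have ip: "(\<Sum>j\<in>UNIV. y $ j * y $ j) = u\<^sup>2" "(\<Sum>j\<in>UNIV. x $ j * y $ j) = s * u"
    by (simp_all add: inner_vec_def)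
  have H: "partial i (\<lambda>v. partial j (\<lambda>w. (norm w)\<^sup>2 * K ((x \<bullet> w) / norm w)) v) y =
    (2 * K s - s * K' s) * (if i = j then 1 else 0)
    + K' s * (x $ i * y $ j / u + y $ i * x $ j / u - s * y $ i * y $ j / u\<^sup>2)
    + k * (x $ i - s * y $ i / u) * (x $ j - s * y $ j / u)" for i j
    unfolding u_def s_def by (rule hessian_angle_energy[OF assms])
  have e: "y $ j * partial i (\<lambda>v. partial j (\<lambda>w. (norm w)\<^sup>2 * K ((x \<bullet> w) / norm w)) v) y =
    (if i = j then (2 * K s - s * K' s) * y $ j else 0)
    + (K' s * (x $ i / u - s * y $ i / u\<^sup>2) - k * (x $ i - s * y $ i / u) * s / u) * (y $ j * y $ j)
    + (K' s * (y $ i / u) + k * (x $ i - s * y $ i / u)) * (x $ j * y $ j)" for i j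
    unfolding H
    by (cases "i = j") (simp_all add: algebra_simps divide_inverse power2_eq_square)
  have "(\<Sum>j\<in>UNIV. y $ j *
      partial i (\<lambda>v. partial j (\<lambda>w. (norm w)\<^sup>2 * K ((x \<bullet> w) / norm w)) v) y) =
     (2 * K s - s * K' s) * y $ i
    + (K' s * (x $ i / u - s * y $ i / u\<^sup>2) - k * (x $ i - s * y $ i / u) * s / u) * u\<^sup>2
    + (K' s * (y $ i / u) + k * (x $ i - s * y $ i / u)) * (s * u)" for i
    unfolding e by (simp only: sum.distrib sum_distrib_left[symmetric] ip) simp
  also have "\<dots> i = (2 * K s - s * K' s) * y $ i + K' s * u * x $ i" for i
    using \<open>u > 0\<close> by (simp add: field_simps power2_eq_square)
  finally have row: "(\<Sum>j\<in>UNIV. y $ j *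
      partial i (\<lambda>v. partial j (\<lambda>w. (norm w)\<^sup>2 * K ((x \<bullet> w) / norm w)) v) y) =
    (2 * K s - s * K' s) * y $ i + K' s * u * x $ i" for i .
  have "(\<Sum>i\<in>UNIV. y $ i * (\<Sum>j\<in>UNIV. y $ j *
      partial i (\<lambda>v. partial j (\<lambda>w. (norm w)\<^sup>2 * K ((x \<bullet> w) / norm w)) v) y)) =
    (\<Sum>i\<in>UNIV. (2 * K s - s * K' s) * (y $ i * y $ i) + K' s * u * (x $ i * y $ i))"
    unfolding row by (simp add: algebra_simps)
  also have "\<dots> = 2 * u\<^sup>2 * K s"
    by (simp only: sum.distrib sum_distrib_left[symmetric] ip)
      (simp add: algebra_simps power2_eq_square)
  finally show ?thesis by (simp add: u_def s_def)
qed

section \<open>A linear differential equation\<close>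

text \<open>After multiplication by \<open>exp (- A)\<close>, with \<open>A\<close> an antiderivative of \<open>a\<close>, a solution is constant.\<close>

lemma linear_ode_zero_propagates:
  fixes f a :: "real \<Rightarrow> real"
  assumes "continuous_on {l<..<m} a"
    and f': "\<And>t. t \<in> {l<..<m} \<Longrightarrow> (f has_real_derivative a t * f t) (at t)"
    and "p \<in> {l<..<m}" "q \<in> {l<..<m}" "f q = 0"
  shows "f p = 0"
proof -
  define c d where "c = min p q" and "d = max p q"
  have sub: "{c..d} \<subseteq> {l<..<m}" and pq: "p \<in> {c..d}" "q \<in> {c..d}"
    using assms(3,4) by (auto simp: c_def d_def)
  define A where "A = (\<lambda>t. integral {c..t} a)"
  have A: "(A has_real_derivative a t) (at t within {c..d})" if "t \<in> {c..d}" for t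
    unfolding A_def
    by (rule integral_has_real_derivative[OF continuous_on_subset[OF assms(1) sub] that])
  have "((\<lambda>t. f t * exp (- A t)) has_real_derivative 0) (at t within {c..d})" if "t \<in> {c..d}" for t
    using that sub
    by (auto intro!: derivative_eq_intros A has_field_derivative_at_within[OF f'])
  then obtain k where "\<And>t. t \<in> {c..d} \<Longrightarrow> f t * exp (- A t) = k"
    using has_field_derivative_zero_constant[of "{c..d}" "\<lambda>t. f t * exp (- A t)"] by auto
  from this[OF pq(1)] this[OF pq(2)] assms(5) show ?thesis by simp
qed

section \<open>The spray of a spherically symmetric metric\<close>

text \<open>With \<open>a = \<phi>\<^sup>2 - s \<phi> \<phi>\<^sub>s\<close>, \<open>b = \<phi> \<phi>\<^sub>s\<close> and \<open>c = b\<^sub>s = \<phi>\<^sub>s\<^sup>2 + \<phi> \<phi>\<^sub>s\<^sub>s\<close>, these two equations for \<open>P\<close> and \<open>Q\<close>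
  compare the coefficients of \<open>x\<close> and of \<open>y\<close> on the two sides of the equation that defines the
  spray. The right-hand sides are \<open>(s b\<^sub>r / r + b\<^sub>s - \<phi> \<phi>\<^sub>r / r) / 2\<close> and \<open>(s a\<^sub>r / r + a\<^sub>s) / 2\<close>.\<close>

lemma spray_coefficients_identity:
  fixes \<phi> p\<^sub>r p\<^sub>s p\<^sub>r\<^sub>s p\<^sub>s\<^sub>s r s P Q :: real
  assumes "r \<noteq> 0" "\<phi> \<noteq> 0" "\<phi> - s * p\<^sub>s + (r\<^sup>2 - s\<^sup>2) * p\<^sub>s\<^sub>s \<noteq> 0"
    and Q: "Q = 1 / (2 * r) * ((- p\<^sub>r + s * p\<^sub>r\<^sub>s + r * p\<^sub>s\<^sub>s) / (\<phi> - s * p\<^sub>s + (r\<^sup>2 - s\<^sup>2) * p\<^sub>s\<^sub>s))"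
    and P: "P = - (Q / \<phi>) * (s * \<phi> + (r\<^sup>2 - s\<^sup>2) * p\<^sub>s) + 1 / (2 * r * \<phi>) * (s * p\<^sub>r + r * p\<^sub>s)"
  shows "P * \<phi> * p\<^sub>s + Q * (\<phi>\<^sup>2 + (p\<^sub>s\<^sup>2 + \<phi> * p\<^sub>s\<^sub>s) * (r\<^sup>2 - s\<^sup>2)) =
      (s * (p\<^sub>r * p\<^sub>s + \<phi> * p\<^sub>r\<^sub>s) / r + (p\<^sub>s\<^sup>2 + \<phi> * p\<^sub>s\<^sub>s) - \<phi> * p\<^sub>r / r) / 2"
    and "P * (\<phi>\<^sup>2 - s * \<phi> * p\<^sub>s) + Q * (r\<^sup>2 - s\<^sup>2) * (\<phi> * p\<^sub>s - s * (p\<^sub>s\<^sup>2 + \<phi> * p\<^sub>s\<^sub>s)) =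
      (s * (2 * \<phi> * p\<^sub>r - s * (p\<^sub>r * p\<^sub>s + \<phi> * p\<^sub>r\<^sub>s)) / r + (\<phi> * p\<^sub>s - s * (p\<^sub>s\<^sup>2 + \<phi> * p\<^sub>s\<^sub>s))) / 2"
proof -
  have 1: "2 * r * Q * (\<phi> - s * p\<^sub>s + (r\<^sup>2 - s\<^sup>2) * p\<^sub>s\<^sub>s) = - p\<^sub>r + s * p\<^sub>r\<^sub>s + r * p\<^sub>s\<^sub>s"
    using assms(1,3) by (simp add: Q)
  have 2: "2 * r * \<phi> * P = - 2 * r * Q * (s * \<phi> + (r\<^sup>2 - s\<^sup>2) * p\<^sub>s) + (s * p\<^sub>r + r * p\<^sub>s)"
    using assms(1,2) unfolding P by (simp add: field_simps)
  have a: "2 * r * (P * \<phi> * p\<^sub>s + Q * (\<phi>\<^sup>2 + (p\<^sub>s\<^sup>2 + \<phi> * p\<^sub>s\<^sub>s) * (r\<^sup>2 - s\<^sup>2))) =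
      s * (p\<^sub>r * p\<^sub>s + \<phi> * p\<^sub>r\<^sub>s) + r * (p\<^sub>s\<^sup>2 + \<phi> * p\<^sub>s\<^sub>s) - \<phi> * p\<^sub>r"
    using 1 2 by algebra
  have b: "2 * r * (P * (\<phi>\<^sup>2 - s * \<phi> * p\<^sub>s) + Q * (r\<^sup>2 - s\<^sup>2) * (\<phi> * p\<^sub>s - s * (p\<^sub>s\<^sup>2 + \<phi> * p\<^sub>s\<^sub>s))) =
      s * (2 * \<phi> * p\<^sub>r - s * (p\<^sub>r * p\<^sub>s + \<phi> * p\<^sub>r\<^sub>s)) + r * (\<phi> * p\<^sub>s - s * (p\<^sub>s\<^sup>2 + \<phi> * p\<^sub>s\<^sub>s))"
    using 1 2 by algebra
  show "P * \<phi> * p\<^sub>s + Q * (\<phi>\<^sup>2 + (p\<^sub>s\<^sup>2 + \<phi> * p\<^sub>s\<^sub>s) * (r\<^sup>2 - s\<^sup>2)) =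
      (s * (p\<^sub>r * p\<^sub>s + \<phi> * p\<^sub>r\<^sub>s) / r + (p\<^sub>s\<^sup>2 + \<phi> * p\<^sub>s\<^sub>s) - \<phi> * p\<^sub>r / r) / 2"
    by (rule mult_left_cancel[of "2 * r", THEN iffD1]) (use assms(1) in \<open>simp_all only: a, simp_all add: field_simps\<close>)
  show "P * (\<phi>\<^sup>2 - s * \<phi> * p\<^sub>s) + Q * (r\<^sup>2 - s\<^sup>2) * (\<phi> * p\<^sub>s - s * (p\<^sub>s\<^sup>2 + \<phi> * p\<^sub>s\<^sub>s)) =
      (s * (2 * \<phi> * p\<^sub>r - s * (p\<^sub>r * p\<^sub>s + \<phi> * p\<^sub>r\<^sub>s)) / r + (\<phi> * p\<^sub>s - s * (p\<^sub>s\<^sup>2 + \<phi> * p\<^sub>s\<^sub>s))) / 2"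
    by (rule mult_left_cancel[of "2 * r", THEN iffD1]) (use assms(1) in \<open>simp_all only: b, simp_all add: field_simps\<close>)
qed

lemma spray_right_hand_side_identity:
  fixes \<phi> p\<^sub>r p\<^sub>s p\<^sub>r\<^sub>s p\<^sub>s\<^sub>s r s u X Y :: real
  assumes "u \<noteq> 0" "r \<noteq> 0"
  defines "d \<equiv> s * u / r * p\<^sub>r + u * p\<^sub>s" and "e \<equiv> s * u / r * p\<^sub>r\<^sub>s + u * p\<^sub>s\<^sub>s"
  shows "1/4 * (2 * (2 * \<phi> * d - s * (d * p\<^sub>s + \<phi> * e)) * Y + 2 * u * (d * p\<^sub>s + \<phi> * e) * X
      - 2 * u\<^sup>2 * \<phi> * (p\<^sub>r * X / r + p\<^sub>s * Y / u)) =
    (u * ((s * (2 * \<phi> * p\<^sub>r - s * (p\<^sub>r * p\<^sub>s + \<phi> * p\<^sub>r\<^sub>s)) / r + (\<phi> * p\<^sub>s - s * (p\<^sub>s\<^sup>2 + \<phi> * p\<^sub>s\<^sub>s))) / 2)) * Y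
    + (u\<^sup>2 * ((s * (p\<^sub>r * p\<^sub>s + \<phi> * p\<^sub>r\<^sub>s) / r + (p\<^sub>s\<^sup>2 + \<phi> * p\<^sub>s\<^sub>s) - \<phi> * p\<^sub>r / r) / 2)) * X"
proof -
  show ?thesis
    unfolding d_def e_def distrib_left right_diff_distrib[of "2 * u\<^sup>2 * \<phi>"]
    using assms(1,2) by (simp add: field_simps power2_eq_square)
qed

text \<open>The spray is the solution \<open>G\<close> of the linear system whose matrix is the fundamental tensor and
  whose right-hand side is the following vector.\<close>

definition geodesic_rhs ::
    "(real^'n::finite \<Rightarrow> real^'n \<Rightarrow> real) \<Rightarrow> real^'n \<Rightarrow> real^'n \<Rightarrow> real^'n" where
  "geodesic_rhs F x y = (\<chi> l. 1/4 *
     ((\<Sum>k\<in>UNIV. y $ k * partial k (\<lambda>z. partial l (\<lambda>w. (F z w)\<^sup>2) y) x)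
       - partial l (\<lambda>z. (F z y)\<^sup>2) x))"

lemma geodesic_spray_eq_matrix_inv_mult:
  "geodesic_spray F x y = matrix_inv (fundamental_tensor F x y) *v geodesic_rhs F x y"
  unfolding geodesic_spray_def geodesic_rhs_def matrix_vector_mult_def
  by (simp add: vec_eq_iff sum_distrib_left mult.left_commute)

text \<open>Only the values of \<open>\<phi>\<close> for \<open>|s| \<le> r\<close> belong to the metric, but its derivatives are needed at
  \<open>s = r\<close> and \<open>s = - r\<close> as well; the open set \<open>U\<close> gives room around these points.\<close>

locale spherical_finsler =
  fixes F :: "real^'n::finite \<Rightarrow> real^'n \<Rightarrow> real"
    and \<phi> :: "real \<Rightarrow> real \<Rightarrow> real"
    and r\<^sub>0 :: real
    and D :: "(real^'n) set"
    and U :: "(real \<times> real) set"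
  assumes card: "CARD('n) \<ge> 2"
    and r0_pos: "0 < r\<^sub>0"
    and D: "D = ball 0 r\<^sub>0 \<or> D = ball 0 r\<^sub>0 - {0}"
    and finsler: "finsler_metric_on D F"
    and U: "open U" "\<And>r s. 0 < r \<Longrightarrow> r < r\<^sub>0 \<Longrightarrow> \<bar>s\<bar> \<le> r \<Longrightarrow> (r, s) \<in> U"
    and smooth: "smooth_on U (\<lambda>(r, s). \<phi> r s)"
    and F_eq: "\<And>x y. x \<in> D \<Longrightarrow> y \<noteq> 0 \<Longrightarrow> F x y = norm y * \<phi> (norm x) ((x \<bullet> y) / norm y)"
begin

abbreviation "\<phi>\<^sub>r \<equiv> d_r \<phi>"
abbreviation "\<phi>\<^sub>s \<equiv> d_s \<phi>"
abbreviation "\<phi>\<^sub>r\<^sub>s \<equiv> d_s (d_r \<phi>)"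
abbreviation "\<phi>\<^sub>s\<^sub>s \<equiv> d_s (d_s \<phi>)"

lemmas smooth_r = smooth_on_d_r_d_s(1)[OF smooth U(1)]
  and smooth_s = smooth_on_d_r_d_s(2)[OF smooth U(1)]
lemmas smooth_rs = smooth_on_d_r_d_s(2)[OF smooth_r U(1)]
  and smooth_ss = smooth_on_d_r_d_s(2)[OF smooth_s U(1)]

lemma open_D: "open D" "open (D - {0})"
  using D by (auto simp: open_Diff)

lemma norm_D: "x \<in> D - {0} \<Longrightarrow> 0 < norm x \<and> norm x < r\<^sub>0"
  using D by auto

lemma norm_in_D: "0 < norm x \<Longrightarrow> norm x < r\<^sub>0 \<Longrightarrow> x \<in> D - {0}"
  using D by auto

lemma abs_angle_le: "\<bar>(x \<bullet> y) / norm y\<bar> \<le> norm x" for x y :: "'a::euclidean_space"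
  using Cauchy_Schwarz_ineq2[of x y] by (cases "y = 0") (auto simp: field_simps)

lemma in_U: "x \<in> D - {0} \<Longrightarrow> (norm x, (x \<bullet> y) / norm y) \<in> U"
  using U(2) norm_D abs_angle_le by blast

text \<open>Because the dimension is at least two, every pair \<open>(r, s)\<close> with \<open>|s| \<le> r\<close> comes from a position and
  a direction. So identities in \<open>(x, y)\<close> descend to identities in \<open>(r, s)\<close>, including the boundary
  \<open>|s| = r\<close>, where \<open>x\<close> and \<open>y\<close> are parallel.\<close>

lemma realize_angle:
  assumes "0 < r" "\<bar>s\<bar> \<le> r"
  obtains x y :: "real^'n" where "norm x = r" "norm y = 1" "x \<bullet> y = s"
proof -
  obtain i j :: 'n where ij: "i \<noteq> j"
    using card card_le_Suc0_iff_eq[of "UNIV::'n set"] by auto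
  define x y :: "real^'n" where "x = r *\<^sub>R axis i 1"
    and "y = (s / r) *\<^sub>R axis i 1 + sqrt (1 - (s / r)\<^sup>2) *\<^sub>R axis j 1"
  have sq: "(s / r)\<^sup>2 \<le> 1"
    using assms by (simp add: power_divide abs_le_square_iff[symmetric])
  have "axis i (1::real) \<bullet> axis j 1 = 0" using ij by (simp add: inner_axis_axis)
  then have "y \<bullet> y = 1" "x \<bullet> y = s"
    using sq assms by (simp_all add: x_def y_def inner_add_left inner_add_right inner_commute
        inner_axis_axis power2_eq_square[symmetric])
  then show thesis using that[of x y] assms by (simp add: x_def norm_eq_sqrt_inner)
qed

lemma phi_pos:
  assumes "0 < r" "r < r\<^sub>0" "\<bar>s\<bar> \<le> r"
  shows "\<phi> r s > 0"
proof -
  obtain x y :: "real^'n" where xy: "norm x = r" "norm y = 1" "x \<bullet> y = s"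
    using realize_angle assms by metis
  then have "x \<in> D" "y \<noteq> 0" using norm_in_D[of x] assms by auto
  then have "F x y > 0" using finsler by (simp add: finsler_metric_on_def)
  then show ?thesis using F_eq[OF \<open>x \<in> D\<close> \<open>y \<noteq> 0\<close>] xy by simp
qed

lemma fundamental_tensor_entry:
  assumes "x \<in> D - {0}" "y \<noteq> 0"
  defines "r \<equiv> norm x" and "u \<equiv> norm y" and "s \<equiv> (x \<bullet> y) / norm y"
  shows "fundamental_tensor F x y $ i $ j =
    ((\<phi> r s)\<^sup>2 - s * \<phi> r s * \<phi>\<^sub>s r s) * (if i = j then 1 else 0)
    + \<phi> r s * \<phi>\<^sub>s r s * (x $ i * y $ j / u + y $ i * x $ j / u - s * y $ i * y $ j / u\<^sup>2)
    + ((\<phi>\<^sub>s r s)\<^sup>2 + \<phi> r s * \<phi>\<^sub>s\<^sub>s r s) * (x $ i - s * y $ i / u) * (x $ j - s * y $ j / u)"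
proof -
  define K where "K = (\<lambda>t. (\<phi> r t)\<^sup>2 / 2)"
  have U': "(r, (x \<bullet> v) / norm v) \<in> U" for v :: "real^'n" using in_U[OF assms(1)] by (simp add: r_def)
  have K: "(K has_real_derivative \<phi> r t * \<phi>\<^sub>s r t) (at t)" if "(r, t) \<in> U" for t
    unfolding K_def
    by (rule derivative_eq_intros smooth_on_prod_has_derivative(3)[OF smooth U(1) that] | simp)+
  have K': "((\<lambda>t. \<phi> r t * \<phi>\<^sub>s r t) has_real_derivative (\<phi>\<^sub>s r t)\<^sup>2 + \<phi> r t * \<phi>\<^sub>s\<^sub>s r t) (at t)"
    if "(r, t) \<in> U" for t
    using DERIV_mult[OF smooth_on_prod_has_derivative(3)[OF smooth U(1) that]
        smooth_on_prod_has_derivative(3)[OF smooth_s U(1) that]]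
    by (simp add: power2_eq_square algebra_simps)
  have "fundamental_tensor F x y $ i $ j =
      partial i (\<lambda>v. partial j (\<lambda>w. 1/2 * (F x w)\<^sup>2) v) y"
    by (simp add: fundamental_tensor_def)
  also have "\<dots> = partial i (\<lambda>v. partial j (\<lambda>w. (norm w)\<^sup>2 * K ((x \<bullet> w) / norm w)) v) y"
    using assms(1,2)
    by (intro partial_cong[of "- {0}"])
      (auto simp: open_Compl F_eq K_def power_mult_distrib r_def)
  also have "\<dots> = (2 * K s - s * (\<phi> r s * \<phi>\<^sub>s r s)) * (if i = j then 1 else 0)
    + \<phi> r s * \<phi>\<^sub>s r s * (x $ i * y $ j / u + y $ i * x $ j / u - s * y $ i * y $ j / u\<^sup>2)
    + ((\<phi>\<^sub>s r s)\<^sup>2 + \<phi> r s * \<phi>\<^sub>s\<^sub>s r s) * (x $ i - s * y $ i / u) * (x $ j - s * y $ j / u)"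
    unfolding u_def s_def
    by (rule hessian_angle_energy[OF assms(2) K K'[OF U'], OF U'])
  finally show ?thesis by (simp add: K_def mult.assoc)
qed

lemma fundamental_tensor_mult:
  assumes "x \<in> D - {0}" "y \<noteq> 0"
  defines "r \<equiv> norm x" and "u \<equiv> norm y" and "s \<equiv> (x \<bullet> y) / norm y"
  shows "(fundamental_tensor F x y *v z) =
    ((\<phi> r s)\<^sup>2 - s * \<phi> r s * \<phi>\<^sub>s r s) *\<^sub>R z
    + (\<phi> r s * \<phi>\<^sub>s r s) *\<^sub>R (((y \<bullet> z) / u) *\<^sub>R x + ((x \<bullet> z - s * (y \<bullet> z) / u) / u) *\<^sub>R y)
    + (((\<phi>\<^sub>s r s)\<^sup>2 + \<phi> r s * \<phi>\<^sub>s\<^sub>s r s) * (x \<bullet> z - s * (y \<bullet> z) / u)) *\<^sub>R (x - (s / u) *\<^sub>R y)"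
proof (rule vec_eq_iff[THEN iffD2], rule allI)
  fix i
  let ?a = "(\<phi> r s)\<^sup>2 - s * \<phi> r s * \<phi>\<^sub>s r s" and ?b = "\<phi> r s * \<phi>\<^sub>s r s"
    and ?c = "(\<phi>\<^sub>s r s)\<^sup>2 + \<phi> r s * \<phi>\<^sub>s\<^sub>s r s"
  have e: "fundamental_tensor F x y $ i $ j * z $ j =
    (if i = j then ?a * z $ j else 0)
    + (?b * (x $ i / u - s * y $ i / u\<^sup>2) - ?c * (x $ i - s * y $ i / u) * s / u) * (y $ j * z $ j)
    + (?b * (y $ i / u) + ?c * (x $ i - s * y $ i / u)) * (x $ j * z $ j)" for j
    unfolding fundamental_tensor_entry[OF assms(1,2), folded r_def u_def s_def]
    by (cases "i = j") (simp_all add: algebra_simps divide_inverse power2_eq_square)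
  have "(fundamental_tensor F x y *v z) $ i = ?a * z $ i +
    (?b * (x $ i / u - s * y $ i / u\<^sup>2) - ?c * (x $ i - s * y $ i / u) * s / u) * (y \<bullet> z)
    + (?b * (y $ i / u) + ?c * (x $ i - s * y $ i / u)) * (x \<bullet> z)"
    unfolding matrix_vector_mult_def
    by (simp add: e sum.distrib inner_vec_def flip: sum_distrib_left)
  also have "\<dots> = (?a *\<^sub>R z
    + ?b *\<^sub>R (((y \<bullet> z) / u) *\<^sub>R x + ((x \<bullet> z - s * (y \<bullet> z) / u) / u) *\<^sub>R y)
    + (?c * (x \<bullet> z - s * (y \<bullet> z) / u)) *\<^sub>R (x - (s / u) *\<^sub>R y)) $ i"
    by (simp add: algebra_simps power2_eq_square diff_divide_distrib add_divide_distrib)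
  finally show "(fundamental_tensor F x y *v z) $ i = (?a *\<^sub>R z
    + ?b *\<^sub>R (((y \<bullet> z) / u) *\<^sub>R x + ((x \<bullet> z - s * (y \<bullet> z) / u) / u) *\<^sub>R y)
    + (?c * (x \<bullet> z - s * (y \<bullet> z) / u)) *\<^sub>R (x - (s / u) *\<^sub>R y)) $ i" .
qed

lemma fundamental_tensor_injective:
  assumes "x \<in> D" "y \<noteq> 0" "fundamental_tensor F x y *v z = 0"
  shows "z = 0"
proof -
  have "inj ((*v) (fundamental_tensor F x y))"
    using finsler assms(1,2) by (simp add: finsler_metric_on_def full_rank_injective)
  then show ?thesis using assms(3) by (metis injD matrix_vector_mult_0_right)
qed

text \<open>The denominator of \<open>Q\<close> is a factor of the determinant of the fundamental tensor: if it vanished,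
  the tensor would have a kernel. If \<open>x\<close> and \<open>y\<close> are parallel, the denominator is \<open>\<phi> - s \<phi>\<^sub>s\<close>, and the
  orthogonal complement of \<open>y\<close> is killed. Otherwise the kernel contains those vectors in the
  plane of \<open>x\<close> and \<open>y\<close> that the differential of \<open>F\<close> annihilates.\<close>

lemma denominator_nonzero:
  assumes "0 < r" "r < r\<^sub>0" "\<bar>s\<bar> \<le> r"
  shows "\<phi> r s - s * \<phi>\<^sub>s r s + (r\<^sup>2 - s\<^sup>2) * \<phi>\<^sub>s\<^sub>s r s \<noteq> 0"
proof
  assume 0: "\<phi> r s - s * \<phi>\<^sub>s r s + (r\<^sup>2 - s\<^sup>2) * \<phi>\<^sub>s\<^sub>s r s = 0"
  obtain x y :: "real^'n" where xy: "norm x = r" "norm y = 1" "x \<bullet> y = s"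
    using realize_angle assms by metis
  have x: "x \<in> D - {0}" and y: "y \<noteq> 0" using norm_in_D[of x] assms xy by auto
  note g = fundamental_tensor_mult[OF x y, unfolded xy, simplified]
  note inj = fundamental_tensor_injective[OF _ y, of x]
  have yy: "y \<bullet> y = 1" "x \<bullet> x = r\<^sup>2" using xy by (simp_all add: dot_square_norm)
  have pos: "\<phi> r s > 0" using phi_pos assms .
  show False
  proof (cases "x = s *\<^sub>R y")
    case True
    then have "r\<^sup>2 = s\<^sup>2" using yy by (metis inner_scaleR_left inner_scaleR_right mult_1_right power2_eq_square)
    with 0 have a: "(\<phi> r s)\<^sup>2 - s * \<phi> r s * \<phi>\<^sub>s r s = 0" by (simp add: power2_eq_square)
    obtain z where z: "z \<noteq> 0" "y \<bullet> z = 0"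
      using orthogonal_to_vector_exists[of y] card by (auto simp: orthogonal_def)
    then have "x \<bullet> z = 0" using True by simp
    then have "fundamental_tensor F x y *v z = 0" using g[of z] a z by simp
    then show False using inj x z by blast
  next
    case False
    define q where "q = r\<^sup>2 - s\<^sup>2"
    \<comment> \<open>The choice of \<open>\<alpha>\<close> makes \<open>z\<close> tangent to the indicatrix: \<open>\<alpha> \<phi> + \<phi>\<^sub>s q = 0\<close>.\<close>
    define \<alpha> where "\<alpha> = - \<phi>\<^sub>s r s * q / \<phi> r s"
    define z where "z = (x - s *\<^sub>R y) + \<alpha> *\<^sub>R y"
    have z: "y \<bullet> z = \<alpha>" "x \<bullet> z = q + \<alpha> * s"
      using xy yy by (simp_all add: z_def inner_add_right inner_diff_right inner_commute q_def power2_eq_square)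
    have \<alpha>: "\<alpha> * \<phi> r s = - \<phi>\<^sub>s r s * q" using pos by (simp add: \<alpha>_def)
    have "fundamental_tensor F x y *v z =
      ((\<phi> r s)\<^sup>2 - s * \<phi> r s * \<phi>\<^sub>s r s + \<phi> r s * \<phi>\<^sub>s r s * \<alpha> + ((\<phi>\<^sub>s r s)\<^sup>2 + \<phi> r s * \<phi>\<^sub>s\<^sub>s r s) * q) *\<^sub>R (x - s *\<^sub>R y)
      + (((\<phi> r s)\<^sup>2 - s * \<phi> r s * \<phi>\<^sub>s r s) * \<alpha> + \<phi> r s * \<phi>\<^sub>s r s * (\<alpha> * s + q)) *\<^sub>R y"
      unfolding g z by (simp add: z_def algebra_simps)
    moreover have "(\<phi> r s)\<^sup>2 - s * \<phi> r s * \<phi>\<^sub>s r s + \<phi> r s * \<phi>\<^sub>s r s * \<alpha> + ((\<phi>\<^sub>s r s)\<^sup>2 + \<phi> r s * \<phi>\<^sub>s\<^sub>s r s) * q = 0"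
      using \<alpha> 0[folded q_def] by algebra
    moreover have "((\<phi> r s)\<^sup>2 - s * \<phi> r s * \<phi>\<^sub>s r s) * \<alpha> + \<phi> r s * \<phi>\<^sub>s r s * (\<alpha> * s + q) = 0"
      using \<alpha> by algebra
    ultimately have "fundamental_tensor F x y *v z = 0" by simp
    then have "z = 0" using inj x by blast
    then have "\<alpha> = 0" using z(1) by simp
    then show False using \<open>z = 0\<close> False by (simp add: z_def)
  qed
qed

lemma invertible_fundamental_tensor:
  "x \<in> D \<Longrightarrow> y \<noteq> 0 \<Longrightarrow> invertible (fundamental_tensor F x y)"
  using fundamental_tensor_injective by (metis invertible_left_inverse matrix_left_invertible_ker)

lemma fundamental_tensor_mult_geodesic_spray:
  assumes "x \<in> D" "y \<noteq> 0"
  shows "fundamental_tensor F x y *v geodesic_spray F x y = geodesic_rhs F x y"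
proof -
  have "fundamental_tensor F x y ** matrix_inv (fundamental_tensor F x y) = mat 1"
    using invertible_fundamental_tensor[OF assms] unfolding invertible_def matrix_inv_def
    by (rule someI2_ex) blast
  then show ?thesis
    by (simp add: geodesic_spray_eq_matrix_inv_mult matrix_vector_mul_assoc)
qed

lemma has_derivative_radial_function:
  assumes "smooth_on U (\<lambda>(r, s). H r s)" "x \<in> D - {0}"
  shows "((\<lambda>z. H (norm z) ((z \<bullet> y) / norm y)) has_derivative
    (\<lambda>v. (v \<bullet> x) / norm x * d_r H (norm x) ((x \<bullet> y) / norm y) +
      (v \<bullet> y) / norm y * d_s H (norm x) ((x \<bullet> y) / norm y))) (at x)"
proof -
  have "x \<noteq> 0" using assms(2) by blast
  have "((\<lambda>z. (norm z, (z \<bullet> y) / norm y)) has_derivative (\<lambda>v. (v \<bullet> x / norm x, (v \<bullet> y) / norm y))) (at x)"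
    using \<open>x \<noteq> 0\<close> by (auto intro!: derivative_eq_intros has_derivative_norm
      simp: sgn_div_norm inner_commute divide_inverse_commute)
  from has_derivative_compose[OF this smooth_on_prod_has_derivative(1)[OF assms(1) U(1) in_U[OF assms(2)]]]
  show ?thesis by simp
qed

lemma partial_F2_y:
  assumes "x \<in> D - {0}" "y \<noteq> 0"
  defines "r \<equiv> norm x" and "s \<equiv> (x \<bullet> y) / norm y"
  shows "partial l (\<lambda>w. (F x w)\<^sup>2) y =
    2 * ((\<phi> r s)\<^sup>2 - s * (\<phi> r s * \<phi>\<^sub>s r s)) * y $ l + 2 * norm y * (\<phi> r s * \<phi>\<^sub>s r s) * x $ l"
proof -
  have U': "(r, s) \<in> U" using in_U[OF assms(1)] by (simp add: r_def s_def)
  have K: "((\<lambda>t. (\<phi> r t)\<^sup>2) has_real_derivative 2 * (\<phi> r s * \<phi>\<^sub>s r s)) (at s)"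
    by (rule derivative_eq_intros smooth_on_prod_has_derivative(3)[OF smooth U(1) U'] | simp)+
  have "partial l (\<lambda>w. (F x w)\<^sup>2) y = partial l (\<lambda>w. (norm w)\<^sup>2 * (\<phi> r ((x \<bullet> w) / norm w))\<^sup>2) y"
    using assms(1,2)
    by (intro partial_cong[of "- {0}"]) (auto simp: open_Compl F_eq power_mult_distrib r_def)
  also have "\<dots> = (2 * (\<phi> r s)\<^sup>2 - s * (2 * (\<phi> r s * \<phi>\<^sub>s r s))) * y $ l + norm y * (2 * (\<phi> r s * \<phi>\<^sub>s r s)) * x $ l"
    unfolding s_def by (rule partial_angle_energy[OF assms(2) K[unfolded s_def]])
  finally show ?thesis by (simp add: algebra_simps)
qed

lemma partial_F2_x:
  assumes "x \<in> D - {0}" "y \<noteq> 0"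
  defines "r \<equiv> norm x" and "s \<equiv> (x \<bullet> y) / norm y"
  shows "partial l (\<lambda>z. (F z y)\<^sup>2) x =
    2 * (norm y)\<^sup>2 * \<phi> r s * (\<phi>\<^sub>r r s * x $ l / r + \<phi>\<^sub>s r s * y $ l / norm y)"
proof -
  have "partial l (\<lambda>z. (F z y)\<^sup>2) x = partial l (\<lambda>z. (norm y)\<^sup>2 * (\<phi> (norm z) ((z \<bullet> y) / norm y))\<^sup>2) x"
    using assms(1,2) by (intro partial_cong[OF open_D(2)]) (auto simp: F_eq power_mult_distrib)
  also have "\<dots> = (norm y)\<^sup>2 * (2 * ((x $ l / r * \<phi>\<^sub>r r s + y $ l / norm y * \<phi>\<^sub>s r s) * \<phi> r s))"
  proof -
    have "((\<lambda>z. (norm y)\<^sup>2 * (\<phi> (norm z) ((z \<bullet> y) / norm y))\<^sup>2) has_derivative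
      (\<lambda>v. (norm y)\<^sup>2 * (2 * (((v \<bullet> x) / r * \<phi>\<^sub>r r s + (v \<bullet> y) / norm y * \<phi>\<^sub>s r s) * \<phi> r s)))) (at x)"
      unfolding r_def s_def
      by (rule derivative_eq_intros has_derivative_radial_function[OF smooth assms(1), of y] refl)+
        (simp add: fun_eq_iff algebra_simps)
    from has_derivative_imp_partial[OF this, of l] show ?thesis by (simp add: inner_axis')
  qed
  finally show ?thesis by (simp add: algebra_simps)
qed

lemma directional_partial_F2:
  assumes "x \<in> D - {0}" "y \<noteq> 0"
  defines "r \<equiv> norm x" and "u \<equiv> norm y" and "s \<equiv> (x \<bullet> y) / norm y"
  defines "d \<equiv> s * u / r * \<phi>\<^sub>r r s + u * \<phi>\<^sub>s r s"
    and "e \<equiv> s * u / r * \<phi>\<^sub>r\<^sub>s r s + u * \<phi>\<^sub>s\<^sub>s r s"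
  shows "(\<Sum>k\<in>UNIV. y $ k * partial k (\<lambda>z. partial l (\<lambda>w. (F z w)\<^sup>2) y) x) =
    2 * (2 * \<phi> r s * d - s * (d * \<phi>\<^sub>s r s + \<phi> r s * e)) * y $ l
      + 2 * u * (d * \<phi>\<^sub>s r s + \<phi> r s * e) * x $ l"
proof -
  let ?\<sigma> = "\<lambda>z. (z \<bullet> y) / norm y"
  let ?f = "\<lambda>z. 2 * ((\<phi> (norm z) (?\<sigma> z))\<^sup>2 - ?\<sigma> z * (\<phi> (norm z) (?\<sigma> z) * \<phi>\<^sub>s (norm z) (?\<sigma> z))) * y $ l
    + 2 * norm y * (\<phi> (norm z) (?\<sigma> z) * \<phi>\<^sub>s (norm z) (?\<sigma> z)) * z $ l"
  let ?d = "\<lambda>v. (v \<bullet> x) / r * \<phi>\<^sub>r r s + (v \<bullet> y) / u * \<phi>\<^sub>s r s"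
  let ?e = "\<lambda>v. (v \<bullet> x) / r * d_r \<phi>\<^sub>s r s + (v \<bullet> y) / u * \<phi>\<^sub>s\<^sub>s r s"
  have "((\<lambda>z. (z \<bullet> y) / norm y) has_derivative (\<lambda>v. (v \<bullet> y) / norm y)) (at x)"
    using assms(2) by (auto intro!: derivative_eq_intros)
  note dd = this has_derivative_radial_function[OF smooth assms(1), of y]
    has_derivative_radial_function[OF smooth_s assms(1), of y]
    bounded_linear.has_derivative[OF bounded_linear_vec_nth] has_derivative_ident
  have 1: "(?f has_derivative (\<lambda>v. 2 * (2 * (?d v * \<phi> r s)
      - (s * (\<phi> r s * ?e v + ?d v * \<phi>\<^sub>s r s) + (v \<bullet> y) / u * (\<phi> r s * \<phi>\<^sub>s r s))) * y $ l
    + (2 * u * (\<phi> r s * \<phi>\<^sub>s r s) * v $ l + 2 * u * (\<phi> r s * ?e v + ?d v * \<phi>\<^sub>s r s) * x $ l))) (at x)"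
    unfolding power2_eq_square u_def r_def s_def
    by (rule has_derivative_eq_rhs, (rule has_derivative_add has_derivative_mult has_derivative_mult_left
      has_derivative_mult_right has_derivative_diff dd)+) (auto simp: algebra_simps)
  have "(\<Sum>k\<in>UNIV. y $ k * partial k (\<lambda>z. partial l (\<lambda>w. (F z w)\<^sup>2) y) x)
    = (\<Sum>k\<in>UNIV. y $ k * partial k ?f x)"
    by (rule sum.cong[OF refl], rule arg_cong[where f = "(*) _"], rule partial_cong[OF open_D(2) assms(1)])
      (simp only: partial_F2_y[OF _ assms(2)])
  also have "\<dots> = 2 * (2 * (?d y * \<phi> r s)
      - (s * (\<phi> r s * ?e y + ?d y * \<phi>\<^sub>s r s) + (y \<bullet> y) / u * (\<phi> r s * \<phi>\<^sub>s r s))) * y $ l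
    + (2 * u * (\<phi> r s * \<phi>\<^sub>s r s) * y $ l + 2 * u * (\<phi> r s * ?e y + ?d y * \<phi>\<^sub>s r s) * x $ l)"
    by (rule sum_partial_eq_directional[OF 1])
  finally have sum: "(\<Sum>k\<in>UNIV. y $ k * partial k (\<lambda>z. partial l (\<lambda>w. (F z w)\<^sup>2) y) x) =
    2 * (2 * (?d y * \<phi> r s)
      - (s * (\<phi> r s * ?e y + ?d y * \<phi>\<^sub>s r s) + (y \<bullet> y) / u * (\<phi> r s * \<phi>\<^sub>s r s))) * y $ l
    + (2 * u * (\<phi> r s * \<phi>\<^sub>s r s) * y $ l + 2 * u * (\<phi> r s * ?e y + ?d y * \<phi>\<^sub>s r s) * x $ l)" .
  have yy: "y \<bullet> y / u = u" using assms(2) by (simp add: u_def dot_square_norm power2_eq_square)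
  have "?d y = d" "?e y = e"
    using assms(2) yy in_U[OF assms(1), of y]
    unfolding d_def e_def r_def s_def u_def by (simp_all add: mixed_partials_commute[OF smooth U(1)] inner_commute)
  then show ?thesis unfolding sum yy by (simp add: algebra_simps)
qed

text \<open>Both sides of the linear system for the spray are combinations of \<open>x\<close> and \<open>y\<close>. Since the
  fundamental tensor is injective, comparing the two coefficients determines the spray.\<close>

proposition geodesic_spray_formula:
  assumes "x \<in> D - {0}" "y \<noteq> 0"
  defines "r \<equiv> norm x" and "u \<equiv> norm y" and "s \<equiv> (x \<bullet> y) / norm y"
  shows "geodesic_spray F x y = (u * spray_P \<phi> r s) *\<^sub>R y + (u\<^sup>2 * spray_Q \<phi> r s) *\<^sub>R x"
proof -
  let ?g = "fundamental_tensor F x y"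
  let ?G = "(u * spray_P \<phi> r s) *\<^sub>R y + (u\<^sup>2 * spray_Q \<phi> r s) *\<^sub>R x"
  have r: "0 < r" "r < r\<^sub>0" "\<bar>s\<bar> \<le> r" using norm_D[OF assms(1)] abs_angle_le by (auto simp: r_def s_def)
  have "u > 0" using assms(2) by (simp add: u_def)
  have ip: "y \<bullet> y = u\<^sup>2" "x \<bullet> x = r\<^sup>2" "x \<bullet> y = s * u" "y \<bullet> x = s * u"
    using assms(2) by (auto simp: u_def r_def s_def dot_square_norm inner_commute)
  note id = spray_coefficients_identity[of r "\<phi> r s" s "\<phi>\<^sub>s r s" "\<phi>\<^sub>s\<^sub>s r s" "spray_Q \<phi> r s" "\<phi>\<^sub>r r s"
      "\<phi>\<^sub>r\<^sub>s r s" "spray_P \<phi> r s", OF _ _ denominator_nonzero[OF r] spray_Q_def spray_P_def]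
  have w: "geodesic_rhs F x y = (u * ((s * (2 * \<phi> r s * \<phi>\<^sub>r r s - s * (\<phi>\<^sub>r r s * \<phi>\<^sub>s r s + \<phi> r s * \<phi>\<^sub>r\<^sub>s r s)) / r
       + (\<phi> r s * \<phi>\<^sub>s r s - s * ((\<phi>\<^sub>s r s)\<^sup>2 + \<phi> r s * \<phi>\<^sub>s\<^sub>s r s))) / 2)) *\<^sub>R y
    + (u\<^sup>2 * ((s * (\<phi>\<^sub>r r s * \<phi>\<^sub>s r s + \<phi> r s * \<phi>\<^sub>r\<^sub>s r s) / r + ((\<phi>\<^sub>s r s)\<^sup>2 + \<phi> r s * \<phi>\<^sub>s\<^sub>s r s)
       - \<phi> r s * \<phi>\<^sub>r r s / r) / 2)) *\<^sub>R x"
    unfolding geodesic_rhs_def directional_partial_F2[OF assms(1,2), folded r_def u_def s_def]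
      partial_F2_x[OF assms(1,2), folded r_def u_def s_def]
      spray_right_hand_side_identity[OF less_imp_neq[OF \<open>u > 0\<close>, symmetric] less_imp_neq[OF r(1), symmetric]]
    by (simp add: vec_eq_iff)
  have "?g *v ?G =
    (u * (spray_P \<phi> r s * ((\<phi> r s)\<^sup>2 - s * \<phi> r s * \<phi>\<^sub>s r s) + spray_Q \<phi> r s * (r\<^sup>2 - s\<^sup>2) *
       (\<phi> r s * \<phi>\<^sub>s r s - s * ((\<phi>\<^sub>s r s)\<^sup>2 + \<phi> r s * \<phi>\<^sub>s\<^sub>s r s)))) *\<^sub>R y
    + (u\<^sup>2 * (spray_P \<phi> r s * \<phi> r s * \<phi>\<^sub>s r s + spray_Q \<phi> r s * ((\<phi> r s)\<^sup>2 +
       ((\<phi>\<^sub>s r s)\<^sup>2 + \<phi> r s * \<phi>\<^sub>s\<^sub>s r s) * (r\<^sup>2 - s\<^sup>2)))) *\<^sub>R x"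
    unfolding fundamental_tensor_mult[OF assms(1,2)] r_def[symmetric] u_def[symmetric] s_def[symmetric]
      inner_add_right inner_scaleR_right ip
    using \<open>u > 0\<close> by (simp add: vec_eq_iff) (simp add: field_simps power2_eq_square)
  also have "\<dots> = geodesic_rhs F x y"
    unfolding w id(1)[OF less_imp_neq[OF r(1), symmetric] less_imp_neq[OF phi_pos[OF r], symmetric]]
      id(2)[OF less_imp_neq[OF r(1), symmetric] less_imp_neq[OF phi_pos[OF r], symmetric]] ..
  also have "\<dots> = ?g *v geodesic_spray F x y"
    using fundamental_tensor_mult_geodesic_spray[of x y] assms(1,2) by simp
  finally have "?g *v (geodesic_spray F x y - ?G) = 0"
    by (simp add: matrix_vector_mult_diff_distrib)
  then have "geodesic_spray F x y - ?G = 0"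
    using fundamental_tensor_injective[of x y] assms(1,2) by blast
  then show ?thesis by simp
qed

section \<open>Regularity of the spray\<close>

text \<open>Cramer's rule expresses the spray by second derivatives of \<open>F\<^sup>2\<close>. In contrast to the formula with
  \<open>P\<close> and \<open>Q\<close>, this shows continuity at the origin, if it belongs to \<open>D\<close>.\<close>

lemma continuous_on_geodesic_spray:
  assumes "y \<noteq> 0"
  shows "continuous_on D (\<lambda>x. geodesic_spray F x y $ k)"
proof -
  let ?S = "D \<times> (- {0 :: real^'n})" and ?g = "\<lambda>x. fundamental_tensor F x y"
  have S: "open ?S" by (intro open_Times open_D open_Compl closed_singleton)
  have F: "smooth_on ?S (\<lambda>p. F (fst p) (snd p))"
    using finsler by (simp add: finsler_metric_on_def case_prod_unfold)
  have F2: "smooth_on ?S (\<lambda>p. (F (fst p) (snd p))\<^sup>2)" "smooth_on ?S (\<lambda>p. 1/2 * (F (fst p) (snd p))\<^sup>2)"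
    by (intro smooth_on_intros F S)+
  have slice: "continuous_on D (\<lambda>x. H (x, y))" if "smooth_on ?S H" for H :: "_ \<Rightarrow> real"
    using smooth_on_imp_continuous_on[OF that] assms
    by (intro continuous_on_compose2[of ?S H D "\<lambda>x. (x, y)"]) (auto intro!: continuous_intros)
  have g: "continuous_on D (\<lambda>x. ?g x $ i $ j)" for i j
    using slice[OF smooth_on_partial_snd[OF smooth_on_partial_snd[OF F2(2) S] S, of i j]]
    by (simp add: fundamental_tensor_def)
  have w: "continuous_on D (\<lambda>x. geodesic_rhs F x y $ l)" for l
    using slice[OF smooth_on_partial_fst[OF smooth_on_partial_snd[OF F2(1) S] S, of _ l]]
      slice[OF smooth_on_partial_fst[OF F2(1) S, of l]]
    unfolding geodesic_rhs_def vec_lambda_beta by (intro continuous_intros) simp_all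
  have G: "geodesic_spray F x y $ k =
      det (\<chi> i j. if j = k then geodesic_rhs F x y $ i else ?g x $ i $ j) / det (?g x)"
    if "x \<in> D" for x
  proof -
    have "det (?g x) \<noteq> 0"
      using invertible_fundamental_tensor[OF that assms] by (simp add: invertible_det_nz)
    then have "geodesic_spray F x y =
        (\<chi> k. det (\<chi> i j. if j = k then geodesic_rhs F x y $ i else ?g x $ i $ j) / det (?g x))"
      using cramer fundamental_tensor_mult_geodesic_spray[OF that assms] by blast
    then show ?thesis by (simp only: vec_lambda_beta)
  qed
  have det: "continuous_on D (\<lambda>x. det (A x))" if "\<And>i j. continuous_on D (\<lambda>x. A x $ i $ j)"
    for A :: "real^'n \<Rightarrow> real^'n^'n"
    unfolding det_def by (intro continuous_intros that)
  have "continuous_on D (\<lambda>x. (\<chi> i j. if j = k then geodesic_rhs F x y $ i else ?g x $ i $ j) $ i $ j)" for i j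
    by (cases "j = k") (simp_all add: g w)
  then have "continuous_on D (\<lambda>x. det (\<chi> i j. if j = k then geodesic_rhs F x y $ i else ?g x $ i $ j) / det (?g x))"
    using invertible_fundamental_tensor[OF _ assms] g
    by (intro continuous_on_divide det) (auto simp: invertible_det_nz)
  then show ?thesis using G by (simp cong: continuous_on_cong)
qed

lemma smooth_spray_coefficients:
  obtains V where "open V" "\<And>r s. 0 < r \<Longrightarrow> r < r\<^sub>0 \<Longrightarrow> \<bar>s\<bar> \<le> r \<Longrightarrow> (r, s) \<in> V"
    and "smooth_on V (\<lambda>p. spray_P \<phi> (fst p) (snd p))" "smooth_on V (\<lambda>p. spray_Q \<phi> (fst p) (snd p))"
proof -
  let ?\<Delta> = "\<lambda>p. \<phi> (fst p) (snd p) - snd p * \<phi>\<^sub>s (fst p) (snd p) +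
    ((fst p)\<^sup>2 - (snd p)\<^sup>2) * \<phi>\<^sub>s\<^sub>s (fst p) (snd p)"
  define V where "V = {p \<in> U. fst p * \<phi> (fst p) (snd p) * ?\<Delta> p \<noteq> 0}"
  note fs = smooth_on_bounded_linear[OF bounded_linear_fst] smooth_on_bounded_linear[OF bounded_linear_snd]
  note sm = smooth smooth_r smooth_s smooth_rs smooth_ss
  note sm' = sm[unfolded case_prod_unfold]
  have "continuous_on U (\<lambda>p. fst p * \<phi> (fst p) (snd p) * ?\<Delta> p)"
    by (intro smooth_on_imp_continuous_on smooth_on_intros sm' fs U(1))
  from continuous_open_preimage[OF this U(1) open_Compl[OF closed_singleton[of 0]]]
  have V: "open V" by (rule back_subst[where P = "open"]) (auto simp: V_def open_Compl)
  have "V \<subseteq> U" by (auto simp: V_def)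
  note sV = sm'[THEN smooth_on_subset, OF U(1) V this]
  have Q: "smooth_on V (\<lambda>p. spray_Q \<phi> (fst p) (snd p))"
    unfolding spray_Q_def by (intro smooth_on_intros sV fs V) (auto simp: V_def)
  have P: "smooth_on V (\<lambda>p. spray_P \<phi> (fst p) (snd p))"
    unfolding spray_P_def by (intro smooth_on_intros sV fs V Q) (auto simp: V_def)
  have "(r, s) \<in> V" if "0 < r" "r < r\<^sub>0" "\<bar>s\<bar> \<le> r" for r s
    using U(2)[OF that] phi_pos[OF that] denominator_nonzero[OF that] that by (simp add: V_def)
  with V P Q that show thesis by blast
qed

lemma smooth_on_angle:
  "smooth_on (- {0}) (\<lambda>w::real^'n. (x \<bullet> w) / norm w)"
  by (rule smooth_on_divide)
    (auto simp: open_Compl smooth_on_norm intro: smooth_on_bounded_linear bounded_linear_inner_right)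

text \<open>The second derivatives in the covariant derivative of a form have to be exchanged with the
  summation over \<open>h\<close>, which requires each single component of the spray to be differentiable.\<close>

lemma smooth_on_geodesic_spray:
  assumes "x \<in> D - {0}"
  shows "smooth_on (- {0}) (\<lambda>w. geodesic_spray F x w $ h)"
proof -
  obtain V where V: "open V" "\<And>r s. 0 < r \<Longrightarrow> r < r\<^sub>0 \<Longrightarrow> \<bar>s\<bar> \<le> r \<Longrightarrow> (r, s) \<in> V"
    and PQ: "smooth_on V (\<lambda>p. spray_P \<phi> (fst p) (snd p))" "smooth_on V (\<lambda>p. spray_Q \<phi> (fst p) (snd p))"
    using smooth_spray_coefficients by metis
  have o: "open (- {0::real^'n})" by (simp add: open_Compl)
  have inV: "(norm x, (x \<bullet> w) / norm w) \<in> V" for w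
    using V(2) norm_D[OF assms] abs_angle_le by blast
  have pair: "smooth_on (- {0}) (\<lambda>w. (norm x, (x \<bullet> w) / norm w))"
    by (intro smooth_on_Pair o smooth_on_const smooth_on_angle)
  have "smooth_on (- {0}) (\<lambda>w. norm w * spray_P \<phi> (norm x) ((x \<bullet> w) / norm w) * w $ h
      + (norm w)\<^sup>2 * spray_Q \<phi> (norm x) ((x \<bullet> w) / norm w) * x $ h)"
    using smooth_on_compose[OF o V(1) PQ(1) pair inV] smooth_on_compose[OF o V(1) PQ(2) pair inV]
    by (intro smooth_on_intros o smooth_on_norm
        smooth_on_bounded_linear[OF bounded_linear_vec_nth]) simp_all
  then show ?thesis
    by (rule smooth_on_cong[OF o]) (simp add: geodesic_spray_formula[OF assms])
qed

lemma radial_spray_component: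
  assumes "x \<in> D - {0}" "w \<noteq> 0"
  shows "geodesic_spray F x w \<bullet> x = (norm w)\<^sup>2 * ((x \<bullet> w) / norm w * spray_P \<phi> (norm x) ((x \<bullet> w) / norm w)
      + (norm x)\<^sup>2 * spray_Q \<phi> (norm x) ((x \<bullet> w) / norm w))"
  unfolding geodesic_spray_formula[OF assms] using assms(2)
  by (simp add: inner_add_left inner_commute[of w x] dot_square_norm field_simps power2_eq_square)

section \<open>Radial parallel forms\<close>

text \<open>For a form proportional to \<open>x\<close>, the sum over \<open>h\<close> in the covariant derivative collects the components
  of the spray into its radial component.\<close>

lemma horizontal_derivative_radial_form:
  assumes f: "smooth_on {0<..<r\<^sub>0} f" and x: "x \<in> D - {0}" and y: "y \<noteq> 0"
  shows "horizontal_derivative F (\<lambda>x. f (norm x) *\<^sub>R x) i j x y =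
    f (norm x) * (if i = j then 1 else 0) + deriv f (norm x) * x $ i * x $ j / norm x
    - f (norm x) * partial i (\<lambda>v. partial j (\<lambda>w. geodesic_spray F x w \<bullet> x) v) y"
proof -
  have o: "open (- {0::real^'n})" by (simp add: open_Compl)
  have r: "norm x \<in> {0<..<r\<^sub>0}" "x \<noteq> 0" using norm_D[OF x] x by auto
  have b: "partial j (\<lambda>z. (f (norm z) *\<^sub>R z) $ i) x =
    f (norm x) * (if i = j then 1 else 0) + deriv f (norm x) * x $ i * x $ j / norm x"
  proof -
    have "((\<lambda>z. f (norm z) * z $ i) has_derivative
        (\<lambda>v. f (norm x) * v $ i + (v \<bullet> sgn x * deriv f (norm x)) * x $ i)) (at x)"
      by (intro has_derivative_mult DERIV_compose_FDERIV
          smooth_on_has_real_derivative[OF f _ r(1)] has_derivative_norm r(2)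
          bounded_linear.has_derivative[OF bounded_linear_vec_nth] has_derivative_ident) simp
    from has_derivative_imp_partial[OF this, of j]
    moreover have "(axis j 1 :: real^'n) $ i = (if i = j then 1 else 0)" by (simp add: axis_def)
    ultimately show ?thesis by (simp add: inner_axis' sgn_div_norm divide_inverse mult_ac)
  qed
  note sm = smooth_on_geodesic_spray[OF x]
  have "(\<Sum>h\<in>UNIV. partial i (\<lambda>v. partial j (\<lambda>w. geodesic_spray F x w $ h) v) y * (f (norm x) *\<^sub>R x) $ h) =
    f (norm x) * (\<Sum>h\<in>UNIV. partial i (\<lambda>v. partial j (\<lambda>w. geodesic_spray F x w $ h) v) y * x $ h)"
    by (simp add: sum_distrib_left mult_ac)
  also have "(\<Sum>h\<in>UNIV. partial i (\<lambda>v. partial j (\<lambda>w. geodesic_spray F x w $ h) v) y * x $ h)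
    = partial i (\<lambda>v. \<Sum>h\<in>UNIV. partial j (\<lambda>w. geodesic_spray F x w $ h) v * x $ h) y"
    using y by (intro partial_sum_right[OF o, symmetric] smooth_on_partial sm o) simp
  also have "\<dots> = partial i (\<lambda>v. partial j (\<lambda>w. geodesic_spray F x w \<bullet> x) v) y"
    unfolding inner_vec_def inner_real_def
    by (rule partial_cong[OF o]) (use y in \<open>simp_all add: partial_sum_right[OF o _ sm]\<close>)
  finally show ?thesis unfolding horizontal_derivative_def b by simp
qed

text \<open>If the form is parallel, the Hessian of \<open>\<langle>x, G\<rangle>\<close> in \<open>y\<close> is known up to the factor \<open>f\<close>. Evaluating it
  twice on \<open>y\<close> gives back \<open>2 \<langle>x, G\<rangle> = 2 |y|\<^sup>2 (s P + r\<^sup>2 Q)\<close>.\<close>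

lemma parallel_radial_equation:
  assumes f: "smooth_on {0<..<r\<^sub>0} f"
    and par: "nonzero_parallel_form_on D F (\<lambda>x. f (norm x) *\<^sub>R x)"
    and r: "0 < r" "r < r\<^sub>0" "\<bar>s\<bar> \<le> r"
  shows "f r + deriv f r * s\<^sup>2 / r = 2 * f r * (s * spray_P \<phi> r s + r\<^sup>2 * spray_Q \<phi> r s)"
proof -
  obtain V where V: "open V" "\<And>r s. 0 < r \<Longrightarrow> r < r\<^sub>0 \<Longrightarrow> \<bar>s\<bar> \<le> r \<Longrightarrow> (r, s) \<in> V"
    and PQ: "smooth_on V (\<lambda>p. spray_P \<phi> (fst p) (snd p))" "smooth_on V (\<lambda>p. spray_Q \<phi> (fst p) (snd p))"
    using smooth_spray_coefficients by metis
  obtain x y :: "real^'n" where xy: "norm x = r" "norm y = 1" "x \<bullet> y = s"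
    using realize_angle r by metis
  have x: "x \<in> D - {0}" and y: "y \<noteq> 0" using norm_in_D[of x] r xy by auto
  define K where "K = (\<lambda>t. t * spray_P \<phi> r t + r\<^sup>2 * spray_Q \<phi> r t)"
  define I where "I = {t. (r, t) \<in> V}"
  have I: "open I" unfolding I_def
    using open_vimage[OF V(1), of "\<lambda>t. (r, t)"] by (simp add: vimage_def continuous_intros)
  have pair: "smooth_on I (\<lambda>t. (r, t))"
    by (intro smooth_on_Pair I smooth_on_const smooth_on_bounded_linear bounded_linear_ident)
  have K: "smooth_on I K"
    unfolding K_def
    using smooth_on_compose[OF I V(1) PQ(1) pair] smooth_on_compose[OF I V(1) PQ(2) pair]
    by (intro smooth_on_intros I smooth_on_bounded_linear[OF bounded_linear_ident]) (auto simp: I_def)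
  have inI: "(x \<bullet> v) / norm v \<in> I" for v
    unfolding I_def using V(2) r abs_angle_le[of x v] xy by auto
  let ?H = "\<lambda>i j. partial i (\<lambda>v. partial j (\<lambda>w. geodesic_spray F x w \<bullet> x) v) y"
  have H: "?H i j = partial i (\<lambda>v. partial j (\<lambda>w. (norm w)\<^sup>2 * K ((x \<bullet> w) / norm w)) v) y" for i j
    using y by (intro partial_cong[of "- {0}"])
      (auto simp: open_Compl radial_spray_component[OF x] K_def xy)
  have euler: "(\<Sum>i\<in>UNIV. y $ i * (\<Sum>j\<in>UNIV. y $ j * ?H i j)) = 2 * K s"
    unfolding H using hessian_angle_energy_quadratic_form[OF y smooth_on_has_real_derivative[OF K I inI]
        smooth_on_has_real_derivative[OF smooth_on_deriv[OF K I] I inI]] xy by simp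
  have parallel: "f r * ?H i j = f r * (if i = j then 1 else 0) + deriv f r * x $ i * x $ j / r" for i j
    using par x y horizontal_derivative_radial_form[OF f x y, of i j] xy
    by (simp add: nonzero_parallel_form_on_def)
  have "f r * (2 * K s) = (\<Sum>i\<in>UNIV. y $ i * (\<Sum>j\<in>UNIV. y $ j * (f r * ?H i j)))"
    unfolding euler[symmetric] by (simp add: sum_distrib_left mult.left_commute)
  also have "\<dots> = (\<Sum>i\<in>UNIV. y $ i * (\<Sum>j\<in>UNIV. y $ j *
       (f r * (if i = j then 1 else 0) + deriv f r * x $ i * x $ j / r)))"
    by (simp only: parallel)
  also have "\<dots> = (\<Sum>i\<in>UNIV. y $ i * (f r * y $ i + deriv f r * x $ i / r * s))"
  proof -
    have "y $ j * (f r * (if i = j then 1 else 0) + deriv f r * x $ i * x $ j / r) =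
      (if i = j then f r * y $ j else 0) + deriv f r * x $ i / r * (x $ j * y $ j)" for i j
      by (simp add: algebra_simps)
    moreover have "(\<Sum>j\<in>UNIV. x $ j * y $ j) = s" using xy(3) by (simp add: inner_vec_def)
    ultimately show ?thesis
      by (simp only: sum.distrib sum_distrib_left[symmetric]) simp
  qed
  also have "\<dots> = f r * (y \<bullet> y) + deriv f r / r * s * (x \<bullet> y)"
    by (simp add: inner_vec_def sum_distrib_left sum.distrib[symmetric] algebra_simps)
  also have "\<dots> = f r + deriv f r * s\<^sup>2 / r"
    using xy by (simp add: dot_square_norm power2_eq_square)
  finally show ?thesis by (simp add: K_def algebra_simps)
qed

text \<open>On the boundary \<open>s = r\<close> the equation of a parallel form becomes a linear homogeneous differential
  equation for \<open>f\<close> with continuous coefficient, so one zero would make \<open>f\<close> and the form vanish.\<close>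

lemma parallel_coefficient_nonzero:
  assumes f: "smooth_on {0<..<r\<^sub>0} f"
    and par: "nonzero_parallel_form_on D F (\<lambda>x. f (norm x) *\<^sub>R x)"
    and q: "q \<in> {0<..<r\<^sub>0}"
  shows "f q \<noteq> 0"
proof
  assume fq: "f q = 0"
  obtain V where V: "open V" "\<And>r s. 0 < r \<Longrightarrow> r < r\<^sub>0 \<Longrightarrow> \<bar>s\<bar> \<le> r \<Longrightarrow> (r, s) \<in> V"
    and PQ: "smooth_on V (\<lambda>p. spray_P \<phi> (fst p) (snd p))" "smooth_on V (\<lambda>p. spray_Q \<phi> (fst p) (snd p))"
    using smooth_spray_coefficients by metis
  \<comment> \<open>This is the equation of a parallel form at \<open>s = r\<close>, solved for \<open>f' / f\<close>.\<close>
  define a where "a = (\<lambda>r. (2 * (r * spray_P \<phi> r r + r\<^sup>2 * spray_Q \<phi> r r) - 1) / r)"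
  have o: "open {0<..<r\<^sub>0}" by simp
  have id: "smooth_on {0<..<r\<^sub>0} (\<lambda>r. r)" by (simp add: smooth_on_bounded_linear bounded_linear_ident)
  have pair: "smooth_on {0<..<r\<^sub>0} (\<lambda>r. (r, r))" by (intro smooth_on_Pair o id)
  have "smooth_on {0<..<r\<^sub>0} a"
    unfolding a_def
    using smooth_on_compose[OF o V(1) PQ(1) pair] smooth_on_compose[OF o V(1) PQ(2) pair] V(2)
    by (intro smooth_on_intros o id) auto
  then have a: "continuous_on {0<..<r\<^sub>0} a" by (rule smooth_on_imp_continuous_on)
  have f': "(f has_real_derivative a t * f t) (at t)" if t: "t \<in> {0<..<r\<^sub>0}" for t
  proof -
    have "f t + deriv f t * t = 2 * f t * (t * spray_P \<phi> t t + t\<^sup>2 * spray_Q \<phi> t t)"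
      using parallel_radial_equation[OF f par, of t t] t by (simp add: power2_eq_square)
    then have "deriv f t = a t * f t" using t by (simp add: a_def field_simps)
    then show ?thesis using smooth_on_has_real_derivative[OF f o t] by simp
  qed
  obtain x where x: "x \<in> D" "f (norm x) *\<^sub>R x \<noteq> 0"
    using par by (auto simp: nonzero_parallel_form_on_def)
  then have "norm x \<in> {0<..<r\<^sub>0}" using norm_D[of x] by auto
  from linear_ode_zero_propagates[OF a f' this q fq] x(2) show False by simp
qed

text \<open>For \<open>s = 0\<close> the prescribed \<open>Q\<close> equals \<open>1 / (2 r\<^sup>2)\<close>, so for \<open>|y| = 1\<close> and \<open>y\<close> orthogonal to
  \<open>x\<close> the spray has the component \<open>1 / (2 r)\<close> in the direction of \<open>x\<close>, which is unbounded near the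
  origin. The spray of a metric that is smooth there is bounded.\<close>

lemma spray_determined_imp_origin_removed:
  assumes "spray_determined_by r\<^sub>0 D F \<phi> P
      (\<lambda>r s. s\<^sup>2 * deriv f r / (2 * r^3 * f r) - s * P r s / r\<^sup>2 + 1 / (2 * r\<^sup>2))"
  shows "0 \<notin> D"
proof
  assume "0 \<in> D"
  obtain i j :: 'n where ij: "i \<noteq> j"
    using card card_le_Suc0_iff_eq[of "UNIV::'n set"] by auto
  \<comment> \<open>The point tends to the origin along an axis orthogonal to \<open>y\<close>, which makes \<open>s = 0\<close>.\<close>
  define y :: "real^'n" where "y = axis j 1"
  have y: "y \<noteq> 0" "norm y = 1" by (auto simp: y_def)
  let ?h = "\<lambda>t::real. geodesic_spray F (t *\<^sub>R axis i 1) y $ i"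
  have h: "?h t = 1 / (2 * t)" if t: "0 < t" "t < r\<^sub>0" for t
  proof -
    let ?x = "t *\<^sub>R axis i 1 :: real^'n"
    have x: "?x \<in> D - {0}" using norm_in_D[of ?x] t by simp
    have "?x \<bullet> y = 0" using ij by (simp add: y_def inner_axis_axis)
    moreover have "y $ i = 0" using ij by (simp add: y_def axis_def)
    moreover have "norm ?x = t" using t by simp
    moreover have "?x $ i = t" by (simp add: axis_def)
    moreover note assms[unfolded spray_determined_by_def Let_def, THEN conjunct2, rule_format, OF x y(1)]
    ultimately have "?h t = 1 / (2 * t\<^sup>2) * t"
      using y(2) by (simp only:) simp
    then show ?thesis using t by (simp add: power2_eq_square)
  qed
  have "isCont (\<lambda>x. geodesic_spray F x y $ i) 0"
    using continuous_on_geodesic_spray[OF y(1)] open_D(1) \<open>0 \<in> D\<close> continuous_on_eq_continuous_at by blast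
  then have "isCont ?h 0"
    by (intro isCont_o2[where f = "\<lambda>t. t *\<^sub>R axis i 1" and g = "\<lambda>x. geodesic_spray F x y $ i"])
      (auto intro!: continuous_intros)
  then have "(?h \<longlongrightarrow> ?h 0) (at_right 0)"
    by (simp add: isCont_def filterlim_at_split)
  then have "((\<lambda>t. t * ?h t) \<longlongrightarrow> 0 * ?h 0) (at_right 0)"
    by (intro tendsto_mult tendsto_ident_at)
  moreover have "\<forall>\<^sub>F t in at_right 0. t * ?h t = 1 / 2"
    by (intro eventually_at_rightI[of 0 r\<^sub>0]) (use r0_pos in \<open>simp_all add: h\<close>)
  then have "((\<lambda>t. t * ?h t) \<longlongrightarrow> 1 / 2) (at_right 0)" by (rule tendsto_eventually)
  ultimately show False using tendsto_unique[of "at_right (0::real)"] by fastforce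
qed

lemma parallel_imp_spray_determined:
  assumes f: "smooth_on {0<..<r\<^sub>0} f"
    and par: "nonzero_parallel_form_on D F (\<lambda>x. f (norm x) *\<^sub>R x)"
  shows "spray_determined_by r\<^sub>0 D F \<phi> (spray_P \<phi>)
      (\<lambda>r s. s\<^sup>2 * deriv f r / (2 * r^3 * f r) - s * spray_P \<phi> r s / r\<^sup>2 + 1 / (2 * r\<^sup>2))"
proof -
  have Q: "s\<^sup>2 * deriv f r / (2 * r^3 * f r) - s * spray_P \<phi> r s / r\<^sup>2 + 1 / (2 * r\<^sup>2) = spray_Q \<phi> r s"
    if r: "0 < r" "r < r\<^sub>0" "\<bar>s\<bar> \<le> r" for r s
  proof -
    have "f r \<noteq> 0" using parallel_coefficient_nonzero[OF f par] r by simp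
    then show ?thesis
      using parallel_radial_equation[OF f par r] r(1)
      by (simp add: field_simps power2_eq_square power3_eq_cube)
  qed
  show ?thesis
    unfolding spray_determined_by_def Let_def
  proof (intro conjI allI ballI impI)
    fix x y :: "real^'n" assume xy: "x \<in> D - {0}" "y \<noteq> 0"
    show "geodesic_spray F x y = (norm y * spray_P \<phi> (norm x) (x \<bullet> y / norm y)) *\<^sub>R y +
      ((norm y)\<^sup>2 * ((x \<bullet> y / norm y)\<^sup>2 * deriv f (norm x) / (2 * norm x ^ 3 * f (norm x)) -
          x \<bullet> y / norm y * spray_P \<phi> (norm x) (x \<bullet> y / norm y) / (norm x)\<^sup>2 + 1 / (2 * (norm x)\<^sup>2))) *\<^sub>R x"
      unfolding geodesic_spray_formula[OF xy]
      using Q[of "norm x" "x \<bullet> y / norm y"] norm_D[OF xy(1)] abs_angle_le[of x y] by simp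
  qed (simp_all add: Q)
qed

text \<open>The prescribed \<open>Q\<close> says that \<open>\<langle>x, G\<rangle> = |y|\<^sup>2 / 2 + c \<langle>x, y\<rangle>\<^sup>2\<close> with \<open>c = f' / (2 r f)\<close>. This is a quadratic
  polynomial in \<open>y\<close>, and \<open>f\<close> times its Hessian is exactly the derivative of the form.\<close>

lemma spray_determined_imp_parallel:
  assumes f: "smooth_on {0<..<r\<^sub>0} f" "\<And>r. r \<in> {0<..<r\<^sub>0} \<Longrightarrow> f r \<noteq> 0"
    and spray: "spray_determined_by r\<^sub>0 D F \<phi> P
      (\<lambda>r s. s\<^sup>2 * deriv f r / (2 * r^3 * f r) - s * P r s / r\<^sup>2 + 1 / (2 * r\<^sup>2))"
  shows "nonzero_parallel_form_on D F (\<lambda>x. f (norm x) *\<^sub>R x)"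
  unfolding nonzero_parallel_form_on_def
proof (intro conjI ballI allI impI)
  have D0: "D - {0} = D" using spray_determined_imp_origin_removed[OF spray] by simp
  have "smooth_on D (norm :: real^'n \<Rightarrow> real)"
    by (rule smooth_on_subset[OF smooth_on_norm]) (use D0 open_D in \<open>auto simp: open_Compl\<close>)
  then have "smooth_on D (\<lambda>x. f (norm x))"
    by (rule smooth_on_compose[OF open_D(1) open_greaterThanLessThan f(1)]) (use norm_D D0 in auto)
  then show "smooth_on D (\<lambda>x. f (norm x) *\<^sub>R x)"
    by (intro smooth_on_scaleR open_D smooth_on_bounded_linear[OF bounded_linear_ident])
  obtain x y :: "real^'n" where "norm x = r\<^sub>0 / 2"
    using realize_angle[of "r\<^sub>0 / 2" 0] r0_pos by auto
  then show "\<exists>x\<in>D. f (norm x) *\<^sub>R x \<noteq> 0"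
    using norm_in_D[of x] f(2)[of "norm x"] r0_pos by auto
next
  fix x y :: "real^'n" and i j
  assume "x \<in> D" and y: "y \<noteq> 0"
  then have x: "x \<in> D - {0}" using spray_determined_imp_origin_removed[OF spray] by auto
  define r where "r = norm x"
  have r: "0 < r" "r < r\<^sub>0" using norm_D[OF x] by (auto simp: r_def)
  have fr: "f r \<noteq> 0" using f(2) r by simp
  define c where "c = deriv f r / (2 * r * f r)"
  have G: "geodesic_spray F x w \<bullet> x = (norm w)\<^sup>2 * (1 / 2 + c * ((x \<bullet> w) / norm w)\<^sup>2)" if "w \<noteq> 0" for w
  proof -
    let ?s = "(x \<bullet> w) / norm w"
    have "geodesic_spray F x w = (norm w * P r ?s) *\<^sub>R w +
        ((norm w)\<^sup>2 * (?s\<^sup>2 * deriv f r / (2 * r^3 * f r) - ?s * P r ?s / r\<^sup>2 + 1 / (2 * r\<^sup>2))) *\<^sub>R x"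
      unfolding r_def
      by (rule spray[unfolded spray_determined_by_def Let_def, THEN conjunct2, rule_format, OF x that])
    then have "geodesic_spray F x w \<bullet> x = norm w * P r ?s * (?s * norm w) +
        ((norm w)\<^sup>2 * (?s\<^sup>2 * deriv f r / (2 * r^3 * f r) - ?s * P r ?s / r\<^sup>2 + 1 / (2 * r\<^sup>2))) * r\<^sup>2"
      using that by (simp add: inner_add_left dot_square_norm r_def inner_commute[of w x])
    also have "\<dots> = (norm w)\<^sup>2 * (1 / 2 + c * ?s\<^sup>2)"
    proof -
      define s where "s = ?s"
      show ?thesis
        unfolding c_def s_def[symmetric]
        using r(1) fr by (simp add: field_simps power2_eq_square power3_eq_cube)
    qed
    finally show ?thesis .
  qed
  define u s where "u = norm y" and "s = (x \<bullet> y) / norm y"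
  have K: "((\<lambda>t. 1 / 2 + c * t\<^sup>2) has_real_derivative 2 * c * t) (at t)" for t
    by (auto intro!: derivative_eq_intros)
  have K': "((\<lambda>t. 2 * c * t) has_real_derivative 2 * c) (at t)" for t
    by (auto intro!: derivative_eq_intros)
  have "partial i (\<lambda>v. partial j (\<lambda>w. geodesic_spray F x w \<bullet> x) v) y =
    partial i (\<lambda>v. partial j (\<lambda>w. (norm w)\<^sup>2 * (\<lambda>t. 1 / 2 + c * t\<^sup>2) ((x \<bullet> w) / norm w)) v) y"
    by (rule partial_cong[of "- {0}"], simp add: open_Compl, simp add: y, rule partial_cong[of "- {0}"])
      (simp_all add: open_Compl G)
  also have "\<dots> = (2 * (1 / 2 + c * s\<^sup>2) - s * (2 * c * s)) * (if i = j then 1 else 0)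
    + 2 * c * s * (x $ i * y $ j / u + y $ i * x $ j / u - s * y $ i * y $ j / u\<^sup>2)
    + 2 * c * (x $ i - s * y $ i / u) * (x $ j - s * y $ j / u)"
    unfolding u_def s_def
    by (rule hessian_angle_energy[OF y K K'])
  also have "\<dots> = (if i = j then 1 else 0) + 2 * c * x $ i * x $ j"
  proof -
    have "2 * (1 / 2 + c * s\<^sup>2) - s * (2 * c * s) = 1" by (simp add: algebra_simps power2_eq_square)
    then show ?thesis by (simp add: algebra_simps power2_eq_square add_divide_distrib diff_divide_distrib)
  qed
  finally show "horizontal_derivative F (\<lambda>x. f (norm x) *\<^sub>R x) i j x y = 0"
    unfolding horizontal_derivative_radial_form[OF f(1) x y] r_def[symmetric]
    using r(1) fr by (cases "i = j") (simp_all add: c_def distrib_left)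
qed

end

theorem proposition5p2:
  fixes F :: "real^'n::finite \<Rightarrow> real^'n \<Rightarrow> real"
    and \<phi> :: "real \<Rightarrow> real \<Rightarrow> real"
    and r\<^sub>0 :: real
    and D :: "(real^'n) set"
  assumes "CARD('n) \<ge> 2"
    and "0 < r\<^sub>0"
    and "D = ball 0 r\<^sub>0 \<or> D = ball 0 r\<^sub>0 - {0}"
    and "finsler_metric_on D F"
    and "spherically_symmetric_on r\<^sub>0 D F \<phi>"
  shows
    "((\<exists>f::real \<Rightarrow> real. smooth_on {0<..<r\<^sub>0} f \<and>
          nonzero_parallel_form_on D F (\<lambda>x. f (norm x) *\<^sub>R x))
      \<longleftrightarrow>
      (\<exists>f::real \<Rightarrow> real. smooth_on {0<..<r\<^sub>0} f \<and> (\<forall>r\<in>{0<..<r\<^sub>0}. f r \<noteq> 0) \<and>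
          (\<exists>P. spray_determined_by r\<^sub>0 D F \<phi> P
            (\<lambda>r s. s\<^sup>2 * deriv f r / (2 * r^3 * f r) - s * P r s / r\<^sup>2 + 1 / (2 * r\<^sup>2)))))
     \<and>
     (\<forall>f::real \<Rightarrow> real. smooth_on {0<..<r\<^sub>0} f \<longrightarrow>
        (nonzero_parallel_form_on D F (\<lambda>x. f (norm x) *\<^sub>R x)
         \<longleftrightarrow>
         (\<forall>r\<in>{0<..<r\<^sub>0}. f r \<noteq> 0) \<and>
          (\<exists>P. spray_determined_by r\<^sub>0 D F \<phi> P
            (\<lambda>r s. s\<^sup>2 * deriv f r / (2 * r^3 * f r) - s * P r s / r\<^sup>2 + 1 / (2 * r\<^sup>2)))))"
proof -
  obtain U where "open U" "{(r, s). 0 < r \<and> r < r\<^sub>0 \<and> \<bar>s\<bar> \<le> r} \<subseteq> U" "smooth_on U (\<lambda>(r, s). \<phi> r s)"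
    and F_eq: "\<forall>x\<in>D. \<forall>y. y \<noteq> 0 \<longrightarrow> F x y = norm y * \<phi> (norm x) ((x \<bullet> y) / norm y)"
    using assms(5) unfolding spherically_symmetric_on_def by (elim conjE exE)
  then interpret spherical_finsler F \<phi> r\<^sub>0 D U
    using assms(1-4) by (intro spherical_finsler.intro) blast+
  have equiv: "nonzero_parallel_form_on D F (\<lambda>x. f (norm x) *\<^sub>R x) \<longleftrightarrow>
      (\<forall>r\<in>{0<..<r\<^sub>0}. f r \<noteq> 0) \<and> (\<exists>P. spray_determined_by r\<^sub>0 D F \<phi> P
        (\<lambda>r s. s\<^sup>2 * deriv f r / (2 * r^3 * f r) - s * P r s / r\<^sup>2 + 1 / (2 * r\<^sup>2)))"
    (is "?parallel \<longleftrightarrow> ?nonzero \<and> (\<exists>P. ?spray P)")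
    if f: "smooth_on {0<..<r\<^sub>0} f" for f
  proof
    assume ?parallel
    then have ?nonzero "?spray (spray_P \<phi>)"
      using parallel_coefficient_nonzero[OF f] parallel_imp_spray_determined[OF f] by simp_all
    then show "?nonzero \<and> (\<exists>P. ?spray P)" by (intro conjI exI)
  next
    assume "?nonzero \<and> (\<exists>P. ?spray P)"
    then obtain P where ?nonzero "?spray P" by (elim conjE exE)
    then show ?parallel by (intro spray_determined_imp_parallel[OF f]) simp_all
  qed
  show ?thesis
    by (intro conjI allI impI equiv) (simp_all only: equiv cong: conj_cong)
qed

end
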